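(* Let $n\ge 1$ be an integer, $s\in(0,1)$, $p>1$ with $n>sp$, and let $\Omega\subset\mathbb{R}^n$ be a bounded open set. Let $d,\lambda\ge 0$, $H\ge 1$, and let $u$ belong to the weak fractional De Giorgi class $\widetilde{\mathrm{DG}}{}^{s,p}(\Omega;d,H,\lambda)$. Then $u\in L^\infty_{\mathrm{loc}}(\Omega)$, and there exists a constant $C\ge 1$, depending only on $n$, $s$, $p$, and $H$, such that $$\|u\|_{L^\infty(B_R(x_0))}\le C\left\{\left(\frac{1}{|B_{2R}(x_0)|}\int_{B_{2R}(x_0)}|u(x)|^p\,dx\right)^{\frac1p}+\mathrm{Tail}_{s,p}(u;x_0,R)+R^{\frac{\lambda+sp}{p}}d\right\}$$ for every $x_0\in\Omega$ and $0<R<\mathrm{dist}(x_0,\partial\Omega)/2$.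
   Context: Notation. $B_R(x_0)$ is the open ball of radius $R$ centered at $x_0$ in $\mathbb{R}^n$; $|E|$ is Lebesgue measure; $v_+=\max\{v,0\}$, $v_-=\max\{-v,0\}$. For an open set $U$, $[u]_{W^{s,p}(U)}^p=\int_U\int_U\frac{|u(x)-u(y)|^p}{|x-y|^{n+sp}}\,dx\,dy$, and $W^{s,p}(U)$ is the space of $u\in L^p(U)$ with $[u]_{W^{s,p}(U)}<\infty$. $L^{p-1}_s(\mathbb{R}^n)$ is the set of measurable $u:\mathbb{R}^n\to\mathbb{R}$ with $\int_{\mathbb{R}^n}\frac{|u(x)|^{p-1}}{(1+|x|)^{n+sp}}\,dx<\infty$. For such $u$, $x_0\in\mathbb{R}^n$, $R>0$, $$\mathrm{Tail}_{s,p}(u;x_0,R)=\left(R^{sp}\int_{\mathbb{R}^n\setminus B_R(x_0)}\frac{|u(x)|^{p-1}}{|x-x_0|^{n+sp}}\,dx\right)^{\frac1{p-1}},\qquad \overline{\mathrm{Tail}}_{s,p}(u;x_0,R)=R^{-\frac{sp}{p-1}}\,\mathrm{Tail}_{s,p}(u;x_0,R).$$ For $k\in\mathbb{R}$, $A^+(k,x_0,R)=\{u>k\}\cap B_R(x_0)$ and $A^-(k,x_0,R)=\{u<k\}\cap B_R(x_0)$. Weak fractional De Giorgi class. Let $d,\lambda\ge0$, $H\ge1$. A function $u\in L^{p-1}_s(\mathbb{R}^n)$ with $u|_\Omega\in W^{s,p}(\Omega)$ belongs to $\widetilde{\mathrm{DG}}{}^{s,p}_\pm(\Omega;d,H,\lambda)$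 (one fixed choice of sign throughout) if $$[(u-k)_\pm]_{W^{s,p}(B_r(x_0))}^p\le H\Big\{R^\lambda d^p|A^\pm(k,x_0,R)|+\frac{R^{(1-s)p}}{(R-r)^p}\|(u-k)_\pm\|_{L^p(B_R(x_0))}^p+\frac{R^{n+sp}}{(R-r)^{n+sp}}\|(u-k)_\pm\|_{L^1(B_R(x_0))}\,\overline{\mathrm{Tail}}_{s,p}((u-k)_\pm;x_0,r)^{p-1}\Big\}$$ for every $x_0\in\Omega$, $0<r<R<\mathrm{dist}(x_0,\partial\Omega)$, and $k\in\mathbb{R}$. Moreover $\widetilde{\mathrm{DG}}{}^{s,p}(\Omega;d,H,\lambda)=\widetilde{\mathrm{DG}}{}^{s,p}_+(\Omega;d,H,\lambda)\cap\widetilde{\mathrm{DG}}{}^{s,p}_-(\Omega;d,H,\lambda)$. *)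

theory Defs
  imports "HOL-Analysis.Analysis" "HOL-Probability.Essential_Supremum"
begin

text \<open>The Euclidean space \<open>\<real>\<^sup>n\<close> is a type \<open>'a :: euclidean_space\<close> with \<open>n = DIM('a)\<close>;
  measurability and integrals refer to Lebesgue measure.\<close>

definition pos_part :: "real \<Rightarrow> real" where
  "pos_part v = max v 0"

definition neg_part :: "real \<Rightarrow> real" where
  "neg_part v = max (- v) 0"

text \<open>The \<open>p\<close>-th power of the Gagliardo seminorm \<open>[u]\<close> of \<open>W\<^bsup>s,p\<^esup>(U)\<close>; it may be infinite.
  On the null set \<open>x = y\<close> the integrand is \<open>0\<close> by the convention \<open>0 / 0 = 0\<close>.\<close>

definition gagliardo_pow :: "real \<Rightarrow> real \<Rightarrow> 'a::euclidean_space set \<Rightarrow> ('a \<Rightarrow> real) \<Rightarrow> ennreal" where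
  "gagliardo_pow s p U u =
     (\<integral>\<^sup>+x\<in>U. (\<integral>\<^sup>+y\<in>U. ennreal (\<bar>u x - u y\<bar> powr p / norm (x - y) powr (real DIM('a) + s * p))
        \<partial>lebesgue) \<partial>lebesgue)"

definition Lp_space :: "real \<Rightarrow> 'a::euclidean_space set \<Rightarrow> ('a \<Rightarrow> real) set" where
  "Lp_space p U = {u. u \<in> borel_measurable (lebesgue_on U) \<and>
     set_integrable lebesgue U (\<lambda>x. \<bar>u x\<bar> powr p)}"

text \<open>Used only for functions in \<open>Lp_space p U\<close>, where the integral is finite.\<close>

definition Lp_norm :: "real \<Rightarrow> 'a::euclidean_space set \<Rightarrow> ('a \<Rightarrow> real) \<Rightarrow> real" where
  "Lp_norm p U u = (LINT x:U|lebesgue. \<bar>u x\<bar> powr p) powr (1 / p)"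

definition Linf_norm :: "'a::euclidean_space set \<Rightarrow> ('a \<Rightarrow> real) \<Rightarrow> ennreal" where
  "Linf_norm U u = esssup (lebesgue_on U) (\<lambda>x. ennreal \<bar>u x\<bar>)"

definition Linf_loc :: "'a::euclidean_space set \<Rightarrow> ('a \<Rightarrow> real) set" where
  "Linf_loc U = {u. u \<in> borel_measurable (lebesgue_on U) \<and>
     (\<forall>K. compact K \<and> K \<subseteq> U \<longrightarrow> Linf_norm K u < \<infinity>)}"

definition frac_sobolev :: "real \<Rightarrow> real \<Rightarrow> 'a::euclidean_space set \<Rightarrow> ('a \<Rightarrow> real) set" where
  "frac_sobolev s p U = {u \<in> Lp_space p U. gagliardo_pow s p U u < \<infinity>}"

text \<open>The space \<open>L\<^bsup>p-1\<^esup>\<^sub>s(\<real>\<^sup>n)\<close>.\<close>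

definition tail_space :: "real \<Rightarrow> real \<Rightarrow> ('a::euclidean_space \<Rightarrow> real) set" where
  "tail_space s p = {u \<in> borel_measurable lebesgue.
     integrable lebesgue (\<lambda>x. \<bar>u x\<bar> powr (p - 1) / (1 + norm x) powr (real DIM('a) + s * p))}"

text \<open>Used only for functions in \<open>tail_space s p\<close>, where the integral is finite.\<close>

definition Tail :: "real \<Rightarrow> real \<Rightarrow> ('a::euclidean_space \<Rightarrow> real) \<Rightarrow> 'a \<Rightarrow> real \<Rightarrow> real" where
  "Tail s p u x0 R =
     (R powr (s * p) *
       (LINT x:- ball x0 R|lebesgue. \<bar>u x\<bar> powr (p - 1) / norm (x - x0) powr (real DIM('a) + s * p)))
     powr (1 / (p - 1))"

definition Tail_bar :: "real \<Rightarrow> real \<Rightarrow> ('a::euclidean_space \<Rightarrow> real) \<Rightarrow> 'a \<Rightarrow> real \<Rightarrow> real" where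
  "Tail_bar s p u x0 R = R powr (- (s * p / (p - 1))) * Tail s p u x0 R"

definition A_plus :: "('a::euclidean_space \<Rightarrow> real) \<Rightarrow> real \<Rightarrow> 'a \<Rightarrow> real \<Rightarrow> 'a set" where
  "A_plus u k x0 R = {x. u x > k} \<inter> ball x0 R"

definition A_minus :: "('a::euclidean_space \<Rightarrow> real) \<Rightarrow> real \<Rightarrow> 'a \<Rightarrow> real \<Rightarrow> 'a set" where
  "A_minus u k x0 R = {x. u x < k} \<inter> ball x0 R"

text \<open>The Caccioppoli-type inequality of the De Giorgi class, for a truncation \<open>w = (u - k)\<^sub>\<plusminus>\<close> and
  the corresponding level set \<open>A\<close>.\<close>

definition caccioppoli ::
  "real \<Rightarrow> real \<Rightarrow> real \<Rightarrow> real \<Rightarrow> real \<Rightarrow> 'a::euclidean_space \<Rightarrow> real \<Rightarrow> real \<Rightarrow> ('a \<Rightarrow> real) \<Rightarrow> 'a set \<Rightarrow> bool"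
where
  "caccioppoli s p d H l x0 r R w A \<longleftrightarrow>
     gagliardo_pow s p (ball x0 r) w \<le> ennreal (H *
       (R powr l * d powr p * measure lebesgue A
        + R powr ((1 - s) * p) / (R - r) powr p * Lp_norm p (ball x0 R) w powr p
        + R powr (real DIM('a) + s * p) / (R - r) powr (real DIM('a) + s * p)
          * Lp_norm 1 (ball x0 R) w * Tail_bar s p w x0 r powr (p - 1)))"

text \<open>For nonempty bounded open \<open>\<Omega>\<close> the frontier is nonempty, so \<open>infdist x0 (frontier \<Omega>)\<close> is the
  distance to the boundary.\<close>

definition weak_DG_plus ::
  "real \<Rightarrow> real \<Rightarrow> 'a::euclidean_space set \<Rightarrow> real \<Rightarrow> real \<Rightarrow> real \<Rightarrow> ('a \<Rightarrow> real) set" where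
  "weak_DG_plus s p \<Omega> d H l = {u \<in> tail_space s p \<inter> frac_sobolev s p \<Omega>.
     \<forall>x0\<in>\<Omega>. \<forall>r R k. 0 < r \<and> r < R \<and> R < infdist x0 (frontier \<Omega>) \<longrightarrow>
       caccioppoli s p d H l x0 r R (\<lambda>x. pos_part (u x - k)) (A_plus u k x0 R)}"

definition weak_DG_minus ::
  "real \<Rightarrow> real \<Rightarrow> 'a::euclidean_space set \<Rightarrow> real \<Rightarrow> real \<Rightarrow> real \<Rightarrow> ('a \<Rightarrow> real) set" where
  "weak_DG_minus s p \<Omega> d H l = {u \<in> tail_space s p \<inter> frac_sobolev s p \<Omega>.
     \<forall>x0\<in>\<Omega>. \<forall>r R k. 0 < r \<and> r < R \<and> R < infdist x0 (frontier \<Omega>) \<longrightarrow>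
       caccioppoli s p d H l x0 r R (\<lambda>x. neg_part (u x - k)) (A_minus u k x0 R)}"

definition weak_DG ::
  "real \<Rightarrow> real \<Rightarrow> 'a::euclidean_space set \<Rightarrow> real \<Rightarrow> real \<Rightarrow> real \<Rightarrow> ('a \<Rightarrow> real) set" where
  "weak_DG s p \<Omega> d H l = weak_DG_plus s p \<Omega> d H l \<inter> weak_DG_minus s p \<Omega> d H l"

end

theory Submission
  imports Defs
begin

text \<open>
  The proof is a De Giorgi iteration, but the gain of integrability comes from an elementary
  fractional Faber-Krahn inequality rather than from a Sobolev embedding. If \<open>w \<ge> 0\<close> is positive only
  on a small part \<open>A\<close> of a ball, then around every point \<open>x\<close> with \<open>w x > 0\<close> there is a ball of radius
  \<open>t\<close> with \<open>t\<^sup>n\<close> comparable to \<open>|A|\<close>, a definite part of which lies in the zero set of \<open>w\<close>. There the Gagliardo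
  integrand is at least \<open>(w x)\<^sup>p / t\<^bsup>n+sp\<^esup>\<close>, and integration gives
  \<open>\<integral>w\<^sup>p \<le> C |A|\<^bsup>sp/n\<^esup> [w]\<^sup>p\<close>. Adding \<open>r\<^bsup>-sp\<^esup> \<integral>w\<^sup>p\<close> to the seminorm makes the inequality true without
  any smallness of \<open>A\<close> (\<open>fractional_faber_krahn\<close>). Only lower bounds of nonnegative integrals over
  subsets enter, so the joint measurability of the double integral is never an issue.

  On a ball of radius \<open>R\<close> take levels \<open>K (1 - 2\<^bsup>-j\<^esup>)\<close> increasing to \<open>K\<close> and radii decreasing from
  \<open>R\<close> to \<open>R/2\<close>. The level set, the \<open>L\<^sup>1\<close> norm and the \<open>L\<^sup>p\<close> norm of the next truncation are all controlled
  by the \<open>L\<^sup>p\<close> norm of the present one (\<open>truncation_gap\<close>), so the Caccioppoli inequality and the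
  Faber-Krahn inequality give \<open>q\<^sub>j\<^sub>+\<^sub>1 \<le> C b\<^sup>j q\<^sub>j\<^bsup>1+sp/n\<^esup>\<close> for the normalised energies \<open>q\<^sub>j\<close>, provided that
  \<open>K\<close> dominates the tail and the term with \<open>d\<close> (\<open>de_giorgi_step\<close>). If \<open>q\<^sub>0\<close> is small, which holds as
  soon as \<open>K\<close> is a large multiple of the \<open>L\<^sup>p\<close> mean, the energies tend to \<open>0\<close> and \<open>u \<le> K\<close> almost
  everywhere on the half ball (\<open>local_upper_bound\<close>).

  The iteration is run on balls of radius \<open>R\<close> about every point \<open>y\<close> of \<open>B\<^sub>R(x\<^sub>0)\<close> instead of once on
  \<open>B\<^sub>2\<^sub>R(x\<^sub>0)\<close>. All outer radii are then at most \<open>R\<close>, so that the factor \<open>R\<^sup>\<lambda>\<close> of the Caccioppoli inequality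
  never turns into \<open>(2R)\<^sup>\<lambda>\<close>, and the constant is independent of \<open>\<lambda>\<close>. The price is a change of
  centre in the tail (\<open>Tail_bar_recentre\<close>). Countably many half balls cover \<open>B\<^sub>R(x\<^sub>0)\<close>, and the lower bound
  is the upper bound for \<open>-u\<close>.
\<close>

section \<open>Integrals over sets for Lebesgue measure\<close>

lemma set_integral_dominated:
  fixes f g :: "'a::euclidean_space \<Rightarrow> real"
  assumes B: "B \<in> sets lebesgue" and f: "f \<in> borel_measurable lebesgue"
    and g: "set_integrable lebesgue B g"
    and le: "\<And>x. x \<in> B \<Longrightarrow> 0 \<le> f x \<and> f x \<le> g x"
  shows "set_integrable lebesgue B f" and "(LINT x:B|lebesgue. f x) \<le> (LINT x:B|lebesgue. g x)"
proof -
  have "set_borel_measurable lebesgue B f"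
    using B f unfolding set_borel_measurable_def by measurable
  then show 1: "set_integrable lebesgue B f"
    by (rule set_integrable_bound[OF g]) (use le in force)
  show "(LINT x:B|lebesgue. f x) \<le> (LINT x:B|lebesgue. g x)"
    by (rule set_integral_mono[OF 1 g]) (use le in auto)
qed

lemma set_integral_nonneg_mono_set:
  fixes f :: "'a::euclidean_space \<Rightarrow> real"
  assumes f: "set_integrable lebesgue B f" and "A \<in> sets lebesgue" "A \<subseteq> B"
    and nn: "\<And>x. 0 \<le> f x"
  shows "(LINT x:A|lebesgue. f x) \<le> (LINT x:B|lebesgue. f x)"
proof -
  have "set_integrable lebesgue A f"
    by (rule set_integrable_subset[OF f]) (use assms in auto)
  then show ?thesis
    unfolding set_lebesgue_integral_def
    by (intro integral_mono)
      (use f nn assms(3) in \<open>auto simp: set_integrable_def indicator_def\<close>)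
qed

lemma set_integral_nonneg_fun:
  fixes f :: "'a::euclidean_space \<Rightarrow> real"
  assumes "\<And>x. 0 \<le> f x"
  shows "0 \<le> (LINT x:A|lebesgue. f x)"
  unfolding set_lebesgue_integral_def using assms by (intro Bochner_Integration.integral_nonneg) auto

lemma set_integral_const_ball:
  "set_integrable lebesgue (ball z r) (\<lambda>_. c::real)"
  "(LINT x:ball z r|lebesgue. c) = c * measure lebesgue (ball z r)"
proof -
  have fin: "emeasure lebesgue (ball z r) < \<infinity>"
    using fmeasurableD2[OF lmeasurable_ball[of z r]] by (simp add: less_top)
  have "integrable lebesgue (\<lambda>x. indicator (ball z r) x *\<^sub>R c)"
    using fin by (intro integrable_scaleR_left) simp
  then show "set_integrable lebesgue (ball z r) (\<lambda>_. c::real)"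
    by (simp add: set_integrable_def)
  show "(LINT x:ball z r|lebesgue. c) = c * measure lebesgue (ball z r)"
    by (simp add: set_lebesgue_integral_def)
qed

lemma superlevel_set_lebesgue:
  fixes w :: "'a::euclidean_space \<Rightarrow> real"
  assumes "w \<in> borel_measurable lebesgue"
  shows "{x. c < w x} \<in> sets lebesgue"
  using measurable_sets[OF assms, of "{c<..}"] by (simp add: vimage_def greaterThan_def)

lemma superlevel_set_ball_lmeasurable:
  fixes w :: "'a::euclidean_space \<Rightarrow> real"
  assumes "w \<in> borel_measurable lebesgue"
  shows "{x \<in> ball z r. c < w x} \<in> lmeasurable"
proof -
  have "{x \<in> ball z r. c < w x} = ball z r \<inter> {x. c < w x}" by auto
  also have "\<dots> \<in> lmeasurable"
    by (rule fmeasurable_Int_fmeasurable[OF lmeasurable_ball superlevel_set_lebesgue[OF assms]])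
  finally show ?thesis .
qed

section \<open>A fractional Faber-Krahn inequality\<close>

text \<open>A ball of radius \<open>t\<close> about a point of a larger ball may stick out of it, but moving its centre
  towards the centre of the larger ball by the fraction \<open>t / (2 r)\<close> of the distance gives a ball of radius
  \<open>t / 2\<close> contained in both.\<close>

lemma measure_ball_inter_ball_ge:
  fixes x z :: "'a::euclidean_space"
  assumes "0 < t" "t \<le> 2 * r" "x \<in> ball z r"
  shows "measure lebesgue (ball z r \<inter> ball x t) \<ge> unit_ball_vol (real DIM('a)) * (t / 2) ^ DIM('a)"
proof -
  define c where "c = x + (t / (2 * r)) *\<^sub>R (z - x)"
  have r: "0 < r" using assms by auto
  have d: "dist z x < r" using assms by simp
  have q: "0 \<le> t / (2 * r)" "t / (2 * r) \<le> 1" using assms r by auto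
  have "dist x c = norm ((t / (2 * r)) *\<^sub>R (z - x))"
    by (simp add: c_def dist_norm)
  also have "\<dots> = t / (2 * r) * dist z x"
    using q assms r by (simp only: norm_scaleR dist_norm abs_of_nonneg)
  also have "\<dots> \<le> t / (2 * r) * r"
    using d q by (intro mult_left_mono) auto
  finally have xc: "dist x c \<le> t / 2" using r by simp
  have "z - c = (1 - t / (2 * r)) *\<^sub>R (z - x)"
    by (simp add: c_def algebra_simps)
  then have "dist z c = (1 - t / (2 * r)) * dist z x"
    using q by (simp add: dist_norm)
  also have "\<dots> \<le> (1 - t / (2 * r)) * r"
    using d q by (intro mult_left_mono) auto
  also have "\<dots> = r - t / 2" using r by (simp add: field_simps)
  finally have zc: "dist z c \<le> r - t / 2" .
  have sub: "ball c (t / 2) \<subseteq> ball z r \<inter> ball x t"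
  proof
    fix y assume "y \<in> ball c (t / 2)"
    then have "dist c y < t / 2" by simp
    with xc zc dist_triangle[of x y c] dist_triangle[of z y c]
    show "y \<in> ball z r \<inter> ball x t" by (simp add: dist_commute)
  qed
  have fm: "ball z r \<inter> ball x t \<in> lmeasurable"
    by (intro lmeasurable_open) auto
  have "measure lebesgue (ball c (t / 2)) \<le> measure lebesgue (ball z r \<inter> ball x t)"
    by (rule measure_mono_fmeasurable[OF sub _ fm]) auto
  then show ?thesis using assms by (simp add: content_ball)
qed

text \<open>The smallness hypothesis leaves a part of measure at least \<open>a\<close> of \<open>ball x t\<close> inside the ball on
  which \<open>w\<close> vanishes; restricting the inner integral to that part gives the bound.\<close>

lemma gagliardo_pow_ge_level_set:
  fixes w :: "'a::euclidean_space \<Rightarrow> real"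
  assumes w: "w \<in> borel_measurable lebesgue" and nn: "\<And>x. 0 \<le> w x"
    and p: "0 < p" and s: "0 < s" and t: "0 < t" "t \<le> 2 * r"
    and int: "set_integrable lebesgue (ball z r) (\<lambda>x. w x powr p)"
    and a: "a = measure lebesgue {x \<in> ball z r. 0 < w x}"
    and small: "2 * a \<le> unit_ball_vol (real DIM('a)) * (t / 2) ^ DIM('a)"
  shows "ennreal (a / t powr (real DIM('a) + s * p) * (LINT x:ball z r|lebesgue. w x powr p))
     \<le> gagliardo_pow s p (ball z r) w"
proof -
  define N where "N = real DIM('a) + s * p"
  have N: "0 < N" unfolding N_def using s p by (simp add: add_pos_pos)
  define U where "U = ball z r"
  have U: "U \<in> lmeasurable" "U \<in> sets lebesgue" by (auto simp: U_def)
  define A where "A = {x \<in> U. 0 < w x}"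
  have A: "A \<in> lmeasurable"
    unfolding A_def U_def by (rule superlevel_set_ball_lmeasurable[OF w])
  have pt: "ennreal (a / t powr N * w x powr p) \<le>
     (\<integral>\<^sup>+y\<in>U. ennreal (\<bar>w x - w y\<bar> powr p / norm (x - y) powr N) \<partial>lebesgue)"
    if x: "x \<in> U" for x
  proof (cases "w x = 0")
    case True then show ?thesis by simp
  next
    case False
    then have wx: "0 < w x" using nn[of x] by linarith
    define E where "E = U \<inter> ball x t - A"
    have UB: "U \<inter> ball x t \<in> lmeasurable"
      unfolding U_def by (intro lmeasurable_open) auto
    have E: "E \<in> lmeasurable"
      unfolding E_def using UB A by (intro fmeasurable.Diff) auto
    have "measure lebesgue (U \<inter> ball x t) \<ge> 2 * a"
      using measure_ball_inter_ball_ge[OF t, of x z] x small by (simp add: U_def)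
    moreover have "measure lebesgue E \<ge> measure lebesgue (U \<inter> ball x t) - measure lebesgue A"
      unfolding E_def using UB A by (intro measure_diff_le_measure_setdiff) auto
    ultimately have Ea: "a \<le> measure lebesgue E"
      by (simp add: a A_def U_def)
    have "ennreal (a / t powr N * w x powr p) \<le> ennreal (w x powr p / t powr N * measure lebesgue E)"
      by (intro ennreal_leI) (use Ea in \<open>simp add: divide_right_mono mult.commute[of _ "w x powr p"] mult_left_mono\<close>)
    also have "\<dots> = ennreal (w x powr p / t powr N) * emeasure lebesgue E"
      unfolding emeasure_eq_measure2[OF E] by (rule ennreal_mult) auto
    also have "\<dots> = (\<integral>\<^sup>+y. ennreal (w x powr p / t powr N) * indicator E y \<partial>lebesgue)"
      using E by (simp add: nn_integral_cmult_indicator fmeasurableD)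
    also have "\<dots> \<le> (\<integral>\<^sup>+y\<in>U. ennreal (\<bar>w x - w y\<bar> powr p / norm (x - y) powr N) \<partial>lebesgue)"
    proof (rule nn_integral_mono)
      fix y
      show "ennreal (w x powr p / t powr N) * indicator E y
        \<le> ennreal (\<bar>w x - w y\<bar> powr p / norm (x - y) powr N) * indicator U y"
      proof (cases "y \<in> E")
        case True
        then have y: "y \<in> U" "dist x y < t" "\<not> 0 < w y" by (auto simp: E_def A_def)
        then have wy: "w y = 0" using nn[of y] by linarith
        with wx have "x \<noteq> y" by auto
        then have "w x powr p / t powr N \<le> w x powr p / norm (x - y) powr N"
          using y N by (intro divide_left_mono mult_pos_pos powr_mono2) (auto simp: dist_norm t)
        then show ?thesis using True y wy wx by (simp add: ennreal_leI)
      qed simp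
    qed
    finally show ?thesis .
  qed
  have "ennreal (a / t powr N * (LINT x:U|lebesgue. w x powr p))
      = ennreal (\<integral>x. indicator U x *\<^sub>R (a / t powr N * w x powr p) \<partial>lebesgue)"
    by (simp add: set_lebesgue_integral_def mult.left_commute[of "indicator U _"])
  also have "\<dots> = (\<integral>\<^sup>+x. ennreal (indicator U x *\<^sub>R (a / t powr N * w x powr p)) \<partial>lebesgue)"
  proof (rule nn_integral_eq_integral[symmetric])
    have "set_integrable lebesgue U (\<lambda>x. a / t powr N * w x powr p)"
      using int unfolding U_def by (intro set_integrable_mult_right)
    then show "integrable lebesgue (\<lambda>x. indicator U x *\<^sub>R (a / t powr N * w x powr p))"
      by (simp add: set_integrable_def)
  qed (auto simp: a)
  also have "\<dots> \<le> gagliardo_pow s p U w"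
    unfolding gagliardo_pow_def N_def[symmetric]
    by (rule nn_integral_mono) (use pt in \<open>auto simp: indicator_def\<close>)
  finally show ?thesis by (simp add: U_def N_def)
qed

text \<open>The radius \<open>\<tau>\<close> is chosen so that the smallness hypothesis of the previous lemma holds with
  equality for balls of radius \<open>2 \<tau>\<close>. If \<open>\<tau>\<close> exceeds \<open>r\<close>, the level set is a fixed portion of the ball, and the
  zeroth order term alone suffices.\<close>

lemma fractional_faber_krahn:
  fixes s p :: real
  assumes s: "0 < s" and p: "0 < p"
  obtains C where "0 < C"
    "\<And>(w :: 'a::euclidean_space \<Rightarrow> real) z r G.
      w \<in> borel_measurable lebesgue \<Longrightarrow> (\<And>x. 0 \<le> w x) \<Longrightarrow> 0 < r \<Longrightarrow> 0 \<le> G \<Longrightarrow>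
      set_integrable lebesgue (ball z r) (\<lambda>x. w x powr p) \<Longrightarrow>
      gagliardo_pow s p (ball z r) w \<le> ennreal G \<Longrightarrow>
      (LINT x:ball z r|lebesgue. w x powr p)
        \<le> C * measure lebesgue {x \<in> ball z r. 0 < w x} powr (s * p / real DIM('a))
            * (G + r powr (- (s * p)) * (LINT x:ball z r|lebesgue. w x powr p))"
proof -
  define n where "n = real DIM('a)"
  have n: "0 < n" by (simp add: n_def)
  define v where "v = unit_ball_vol n"
  have v: "0 < v" using n by (simp add: v_def)
  define b where "b = s * p / n"
  have sp: "0 < s * p" using s p by simp
  have b: "0 < b" using n sp by (simp add: b_def)
  define C1 where "C1 = 2 powr (n + 1) * 2 powr (s * p) / v"
  define C where "C = (C1 + 1) * (2 / v) powr b"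
  have C1: "0 < C1" using v by (simp add: C1_def)
  have C: "0 < C" unfolding C_def using C1 v by (intro mult_pos_pos) auto
  show thesis
  proof (rule that[OF C])
    fix w :: "'a \<Rightarrow> real" and z r G
    assume w: "w \<in> borel_measurable lebesgue" and nn: "\<And>x. 0 \<le> w x" and r: "0 < r" and G: "0 \<le> G"
      and int: "set_integrable lebesgue (ball z r) (\<lambda>x. w x powr p)"
      and gag: "gagliardo_pow s p (ball z r) w \<le> ennreal G"
    define a where "a = measure lebesgue {x \<in> ball z r. 0 < w x}"
    define I where "I = (LINT x:ball z r|lebesgue. w x powr p)"
    have I0: "0 \<le> I" unfolding I_def by (rule set_integral_nonneg_fun) simp
    have Am: "{x \<in> ball z r. 0 < w x} \<in> lmeasurable"
      by (rule superlevel_set_ball_lmeasurable[OF w])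
    have "I \<le> C * a powr b * (G + r powr (- (s * p)) * I)"
    proof (cases "a = 0")
      case True
      then have "{x \<in> ball z r. 0 < w x} \<in> null_sets lebesgue"
        using Am emeasure_eq_measure2[OF Am] by (simp add: a_def null_sets_def fmeasurableD)
      then have "AE x in lebesgue. x \<notin> {x \<in> ball z r. 0 < w x}"
        by (rule AE_not_in)
      then have "AE x in lebesgue. indicator (ball z r) x *\<^sub>R (w x powr p) = 0"
        by eventually_elim (use nn in \<open>auto simp: indicator_def less_le\<close>)
      then have "I = 0"
        unfolding I_def set_lebesgue_integral_def by (rule integral_eq_zero_AE)
      then show ?thesis using C G by simp
    next
      case False
      then have a: "0 < a" unfolding a_def by (simp add: less_le)
      define \<tau> where "\<tau> = (2 * a / v) powr (1 / n)"
      have tau: "0 < \<tau>" using a v by (simp add: \<tau>_def)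
      have taun: "\<tau> powr n = 2 * a / v" using a v n by (simp add: \<tau>_def powr_powr)
      have tausp: "\<tau> powr (s * p) = (2 / v) powr b * a powr b"
      proof -
        have "\<tau> powr (s * p) = (2 / v * a) powr b" by (simp add: \<tau>_def powr_powr b_def)
        also have "\<dots> = (2 / v) powr b * a powr b" by (rule powr_mult)
        finally show ?thesis .
      qed
      show ?thesis
      proof (cases "\<tau> \<le> r")
        case True
        have "\<tau> ^ DIM('a) = 2 * a / v"
          using taun tau by (simp add: n_def powr_realpow)
        then have "ennreal (a / (2 * \<tau>) powr (n + s * p) * I) \<le> gagliardo_pow s p (ball z r) w"
          unfolding I_def n_def
          by (intro gagliardo_pow_ge_level_set[OF w nn p s _ _ int a_def])
            (use tau True v in \<open>auto simp: v_def n_def\<close>)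
        also note gag
        finally have "a / (2 * \<tau>) powr (n + s * p) * I \<le> G"
          using G by (simp add: ennreal_le_iff)
        then have "I \<le> G * (2 * \<tau>) powr (n + s * p) / a"
          using a tau by (simp add: field_simps)
        also have "(2 * \<tau>) powr (n + s * p) = 2 powr n * 2 powr (s*p) * (\<tau> powr n * \<tau> powr (s * p))"
          using tau by (simp add: powr_mult powr_add)
        also have "G * \<dots> / a = C1 * (2 / v) powr b * a powr b * G"
          using a unfolding taun tausp C1_def by (simp add: powr_add)
        also have "\<dots> \<le> C * a powr b * (G + r powr (- (s * p)) * I)"
        proof -
          have "C1 * (2 / v) powr b \<le> C"
            unfolding C_def by (intro mult_right_mono) auto
          moreover have "G \<le> G + r powr (- (s * p)) * I" using I0 by simp
          ultimately show ?thesis using G C by (intro mult_mono) auto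
        qed
        finally show ?thesis .
      next
        case False
        have "r powr (s * p) \<le> \<tau> powr (s * p)"
          using False r sp by (intro powr_mono2) auto
        then have "1 \<le> (2 / v) powr b * a powr b * r powr (- (s * p))"
          using r unfolding tausp by (simp add: powr_minus field_simps)
        then have "1 * I \<le> (2 / v) powr b * a powr b * r powr (- (s * p)) * I"
          using I0 by (intro mult_right_mono)
        also have "\<dots> = (2 / v) powr b * a powr b * (r powr (- (s * p)) * I)" by simp
        also have "\<dots> \<le> C * a powr b * (G + r powr (- (s * p)) * I)"
          using C1 C G I0 by (intro mult_mono) (auto simp: C_def algebra_simps)
        finally show ?thesis by simp
      qed
    qed
    then show "(LINT x:ball z r|lebesgue. w x powr p)
        \<le> C * measure lebesgue {x \<in> ball z r. 0 < w x} powr (s * p / real DIM('a))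
            * (G + r powr (- (s * p)) * (LINT x:ball z r|lebesgue. w x powr p))"
      by (simp add: I_def a_def b_def n_def)
  qed
qed

section \<open>The De Giorgi iteration\<close>

text \<open>At the threshold \<open>\<delta> = C\<^bsup>-1/\<beta>\<^esup> b\<^bsup>-1/\<beta>\<^sup>2\<^esup>\<close> the geometric sequence \<open>\<delta> b\<^bsup>-j/\<beta>\<^esup>\<close> solves the recursion with
  equality, and it dominates \<open>q\<close> by induction.\<close>

lemma fast_geometric_convergence:
  fixes C b \<beta> :: real and q :: "nat \<Rightarrow> real"
  assumes C: "0 < C" and b: "1 < b" and \<beta>: "0 < \<beta>"
    and nn: "\<And>j. 0 \<le> q j"
    and rec: "\<And>j. q (Suc j) \<le> C * b powr real j * q j powr (1 + \<beta>)"
    and q0: "q 0 \<le> C powr (- 1 / \<beta>) * b powr (- 1 / \<beta>\<^sup>2)"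
  shows "q \<longlonglongrightarrow> 0"
proof -
  define \<delta> where "\<delta> = C powr (- 1 / \<beta>) * b powr (- 1 / \<beta>\<^sup>2)"
  have \<delta>: "0 < \<delta>" using C b by (simp add: \<delta>_def)
  have \<delta>b: "\<delta> powr \<beta> = inverse C * b powr (- 1 / \<beta>)"
    using C b \<beta> by (simp add: \<delta>_def powr_mult powr_powr power2_eq_square) (simp add: powr_minus divide_inverse)
  have bound: "q j \<le> \<delta> * b powr (- real j / \<beta>)" for j
  proof (induction j)
    case 0 show ?case using q0 b by (simp add: \<delta>_def)
  next
    case (Suc j)
    have "q j powr (1 + \<beta>) \<le> (\<delta> * b powr (- real j / \<beta>)) powr (1 + \<beta>)"
      using Suc nn \<beta> by (intro powr_mono2) auto
    also have "\<dots> = \<delta> * \<delta> powr \<beta> * (b powr (- real j / \<beta>) * b powr (- real j))"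
    proof -
      have "\<delta> powr (1 + \<beta>) = \<delta> * \<delta> powr \<beta>"
        using \<delta> by (simp add: powr_add)
      moreover have "(b powr (- real j / \<beta>)) powr (1 + \<beta>) = b powr (- real j / \<beta> + - real j)"
        unfolding powr_powr using \<beta> by (intro arg_cong[of _ _ "(powr) b"]) (simp add: distrib_left)
      moreover have "b powr (- real j / \<beta> + - real j) = b powr (- real j / \<beta>) * b powr (- real j)"
        by (rule powr_add)
      ultimately show ?thesis by (simp add: powr_mult)
    qed
    finally have "C * b powr real j * q j powr (1 + \<beta>)
        \<le> C * b powr real j * (\<delta> * \<delta> powr \<beta> * (b powr (- real j / \<beta>) * b powr (- real j)))"
      using C b by (intro mult_left_mono) auto
    also have "\<dots> = \<delta> * (b powr (- 1 / \<beta>) * b powr (- real j / \<beta>)) * (b powr real j * b powr (- real j))"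
      using C by (simp add: \<delta>b)
    also have "\<dots> = \<delta> * b powr (- real (Suc j) / \<beta>)"
      using b by (simp add: powr_add[symmetric] add_divide_distrib diff_divide_distrib)
    finally show ?case using rec[of j] by linarith
  qed
  have lim: "(\<lambda>j. \<delta> * b powr (- real j / \<beta>)) \<longlonglongrightarrow> 0"
  proof -
    have eq: "b powr (- real j / \<beta>) = (b powr (- 1 / \<beta>)) ^ j" for j
      using b by (simp add: powr_realpow[symmetric] powr_powr)
    have "b powr (- 1 / \<beta>) < 1"
      using b \<beta> by (simp add: powr_less_one)
    then have "(\<lambda>j. (b powr (- 1 / \<beta>)) ^ j) \<longlonglongrightarrow> 0"
      by (intro LIMSEQ_power_zero) simp
    then show ?thesis unfolding eq by (rule tendsto_mult_right_zero)
  qed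
  show ?thesis
    by (rule tendsto_sandwich[OF _ _ tendsto_const lim]) (use nn bound in auto)
qed

lemma Lp_norm_powr:
  assumes "0 < p"
  shows "Lp_norm p U u powr p = (LINT x:U|lebesgue. \<bar>u x\<bar> powr p)"
proof -
  have "0 \<le> (LINT x:U|lebesgue. \<bar>u x\<bar> powr p)" by (rule set_integral_nonneg_fun) simp
  then show ?thesis using assms by (simp add: Lp_norm_def powr_powr)
qed

lemma Lp_norm_one:
  "Lp_norm 1 U u = (LINT x:U|lebesgue. \<bar>u x\<bar>)"
proof -
  have "0 \<le> (LINT x:U|lebesgue. \<bar>u x\<bar>)" by (rule set_integral_nonneg_fun) simp
  then show ?thesis by (simp add: Lp_norm_def)
qed

lemma Tail_powr:
  fixes u :: "'a::euclidean_space \<Rightarrow> real"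
  assumes "1 < p"
  shows "Tail s p u y r powr (p - 1) = r powr (s * p) *
     (LINT x:- ball y r|lebesgue. \<bar>u x\<bar> powr (p - 1) / norm (x - y) powr (real DIM('a) + s * p))"
proof -
  have "0 \<le> (LINT x:- ball y r|lebesgue. \<bar>u x\<bar> powr (p - 1) / norm (x - y) powr (real DIM('a) + s * p))"
    by (rule set_integral_nonneg_fun) simp
  then show ?thesis using assms by (simp add: Tail_def powr_powr)
qed

lemma Tail_bar_powr:
  fixes u :: "'a::euclidean_space \<Rightarrow> real"
  assumes "1 < p" "0 < r"
  shows "Tail_bar s p u y r powr (p - 1) =
     (LINT x:- ball y r|lebesgue. \<bar>u x\<bar> powr (p - 1) / norm (x - y) powr (real DIM('a) + s * p))"
proof -
  have "Tail_bar s p u y r powr (p - 1) = r powr (- (s * p)) * Tail s p u y r powr (p - 1)"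
    using assms by (simp add: Tail_bar_def powr_mult powr_powr)
  then show ?thesis using assms by (simp add: Tail_powr powr_minus field_simps)
qed

lemma pos_part_measurable:
  assumes "u \<in> borel_measurable M"
  shows "(\<lambda>x. pos_part (u x - k)) \<in> borel_measurable M"
  unfolding pos_part_def using assms by measurable

lemma pos_part_powr_integrable:
  fixes u :: "'a::euclidean_space \<Rightarrow> real"
  assumes u: "u \<in> borel_measurable lebesgue" and "0 \<le> k" "0 \<le> p"
    and int: "set_integrable lebesgue (ball y r) (\<lambda>x. \<bar>u x\<bar> powr p)"
  shows "set_integrable lebesgue (ball y r) (\<lambda>x. pos_part (u x - k) powr p)"
    and "(LINT x:ball y r|lebesgue. pos_part (u x - k) powr p) \<le> (LINT x:ball y r|lebesgue. \<bar>u x\<bar> powr p)"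
proof -
  have m: "(\<lambda>x. pos_part (u x - k) powr p) \<in> borel_measurable lebesgue"
    using pos_part_measurable[OF u] by measurable
  have le: "0 \<le> pos_part (u x - k) powr p \<and> pos_part (u x - k) powr p \<le> \<bar>u x\<bar> powr p" for x
    using assms by (auto simp: pos_part_def intro!: powr_mono2)
  show "set_integrable lebesgue (ball y r) (\<lambda>x. pos_part (u x - k) powr p)"
    and "(LINT x:ball y r|lebesgue. pos_part (u x - k) powr p) \<le> (LINT x:ball y r|lebesgue. \<bar>u x\<bar> powr p)"
    using set_integral_dominated[OF _ m int] le by auto
qed

text \<open>Where \<open>u\<close> exceeds the higher level \<open>k + h\<close>, the truncation at \<open>k\<close> is at least \<open>h\<close>; Chebyshev's
  argument then trades powers of \<open>h\<close> for lower powers of the truncation.\<close>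

lemma truncation_gap:
  fixes u :: "'a::euclidean_space \<Rightarrow> real"
  assumes u: "u \<in> borel_measurable lebesgue" and h: "0 < h" and p: "1 < p"
    and int: "set_integrable lebesgue (ball y r) (\<lambda>x. pos_part (u x - k) powr p)"
  defines "Y \<equiv> (LINT x:ball y r|lebesgue. pos_part (u x - k) powr p)"
  shows "h powr p * measure lebesgue (A_plus u (k + h) y r) \<le> Y"
    and "(LINT x:ball y r|lebesgue. pos_part (u x - (k + h)) powr p) \<le> Y"
    and "set_integrable lebesgue (ball y r) (\<lambda>x. pos_part (u x - (k + h)) powr p)"
    and "h powr (p - 1) * (LINT x:ball y r|lebesgue. pos_part (u x - (k + h))) \<le> Y"
proof -
  define w w' where "w = (\<lambda>x. pos_part (u x - k))" and "w' = (\<lambda>x. pos_part (u x - (k + h)))"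
  have w'm: "w' \<in> borel_measurable lebesgue" unfolding w'_def by (rule pos_part_measurable[OF u])
  have w'm2: "(\<lambda>x. w' x powr p) \<in> borel_measurable lebesgue"
      "(\<lambda>x. h powr (p - 1) * w' x) \<in> borel_measurable lebesgue"
    using w'm by measurable
  have ww': "0 \<le> w' x" "w' x \<le> w x" for x using h by (auto simp: w_def w'_def pos_part_def)
  define A where "A = A_plus u (k + h) y r"
  have "A = {x \<in> ball y r. k + h < u x}" by (auto simp: A_def A_plus_def)
  then have A: "A \<in> lmeasurable" using superlevel_set_ball_lmeasurable[OF u] by simp
  have hw: "h \<le> w x" if "0 < w' x" for x
    using that by (auto simp: w_def w'_def pos_part_def max_def split: if_splits)
  have hA: "h \<le> w x" if "x \<in> A" for x
    using that by (auto simp: w_def A_def A_plus_def pos_part_def)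
  have int': "set_integrable lebesgue (ball y r) (\<lambda>x. w x powr p)" using int by (simp add: w_def)
  have Y: "Y = (LINT x:ball y r|lebesgue. w x powr p)" by (simp add: Y_def w_def)
  have "h powr p * measure lebesgue A = (LINT x:ball y r|lebesgue. h powr p * indicator A x)"
  proof -
    have "A \<inter> ball y r = A" by (auto simp: A_def A_plus_def)
    then have "(\<lambda>x. indicator (ball y r) x * indicator A x) = (indicator A :: 'a \<Rightarrow> real)"
      by (auto simp: indicator_def fun_eq_iff)
    then have "(LINT x:ball y r|lebesgue. indicator A x) = measure lebesgue A"
      by (simp add: set_lebesgue_integral_def)
    then show ?thesis by simp
  qed
  also have "\<dots> \<le> Y" unfolding Y
  proof (rule set_integral_dominated(2)[OF _ _ int'])
    show "(\<lambda>x. h powr p * indicator A x) \<in> borel_measurable lebesgue"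
      using A by (intro borel_measurable_times borel_measurable_const borel_measurable_indicator) auto
    show "0 \<le> h powr p * indicator A x \<and> h powr p * indicator A x \<le> w x powr p" for x
      using hA[of x] h p by (auto simp: indicator_def intro!: powr_mono2)
  qed simp
  finally show "h powr p * measure lebesgue (A_plus u (k + h) y r) \<le> Y" by (simp add: A_def)
  have "0 \<le> w' x powr p \<and> w' x powr p \<le> w x powr p" for x
    using ww'[of x] p by (auto intro!: powr_mono2)
  from set_integral_dominated[OF _ w'm2(1) int' this]
  show "(LINT x:ball y r|lebesgue. pos_part (u x - (k + h)) powr p) \<le> Y"
    and "set_integrable lebesgue (ball y r) (\<lambda>x. pos_part (u x - (k + h)) powr p)"
    by (auto simp: Y w'_def)
  have pt: "0 \<le> h powr (p - 1) * w' x \<and> h powr (p - 1) * w' x \<le> w x powr p" for x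
  proof (cases "0 < w' x")
    case True
    have "h powr (p - 1) * w' x \<le> w x powr (p - 1) * w x"
      using hw[OF True] ww'[of x] h p by (intro mult_mono powr_mono2) auto
    also have "\<dots> = w x powr p"
      using hw[OF True] h by (simp add: powr_diff)
    finally show ?thesis using True by simp
  next
    case False
    then have "w' x = 0" using ww'[of x] by linarith
    then show ?thesis by simp
  qed
  have "(LINT x:ball y r|lebesgue. h powr (p - 1) * w' x) \<le> Y"
    unfolding Y by (rule set_integral_dominated(2)[OF _ w'm2(2) int' pt]) simp
  then show "h powr (p - 1) * (LINT x:ball y r|lebesgue. pos_part (u x - (k + h))) \<le> Y"
    by (simp add: w'_def)
qed

text \<open>One parameter \<open>\<tau>\<close> measures both the gap \<open>\<rho> - r\<close> relative to \<open>R\<close> and the gap \<open>h\<close> relative to \<open>K\<close>.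
  The two hypotheses on \<open>K\<close> bring the \<open>d\<close> term and the tail term of the Caccioppoli
  inequality to the size \<open>R\<^bsup>-sp\<^esup> Y\<close> of the local term, where \<open>Y\<close> is the energy at level \<open>k\<close>.
  The Faber-Krahn inequality then adds the factor \<open>|A|\<^sup>\<beta>\<close>, which is bounded by a power of \<open>Y\<close>.\<close>

lemma de_giorgi_step:
  fixes s p H M :: real
  assumes s: "0 < s" "s < 1" and p: "1 < p" and H: "1 \<le> H" and M: "0 \<le> M"
  defines "N \<equiv> real DIM('a::euclidean_space) + s * p" and "\<beta> \<equiv> s * p / real DIM('a)"
  obtains C where "0 < C"
    "\<And>(u :: 'a \<Rightarrow> real) y R d l K r \<rho> k h \<tau> \<Theta>.
      u \<in> borel_measurable lebesgue \<Longrightarrow> 0 < R \<Longrightarrow> 0 < K \<Longrightarrow> 0 \<le> l \<Longrightarrow>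
      R / 2 \<le> r \<Longrightarrow> r < \<rho> \<Longrightarrow> \<rho> \<le> R \<Longrightarrow> 0 \<le> k \<Longrightarrow>
      2 \<le> \<tau> \<Longrightarrow> R / \<tau> \<le> \<rho> - r \<Longrightarrow> K / \<tau> \<le> h \<Longrightarrow>
      set_integrable lebesgue (ball y R) (\<lambda>x. \<bar>u x\<bar> powr p) \<Longrightarrow>
      caccioppoli s p d H l y r \<rho> (\<lambda>x. pos_part (u x - (k + h))) (A_plus u (k + h) y \<rho>) \<Longrightarrow>
      R powr (l + s * p) * d powr p \<le> K powr p \<Longrightarrow>
      R powr (s * p) * Tail_bar s p (\<lambda>x. pos_part (u x - (k + h))) y r powr (p - 1) \<le> M * K powr (p - 1) \<Longrightarrow>
      \<Theta> = K powr p * R powr real DIM('a) \<Longrightarrow>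
      (LINT x:ball y r|lebesgue. pos_part (u x - (k + h)) powr p) / \<Theta>
       \<le> C * \<tau> powr (N + p + p * \<beta>)
          * ((LINT x:ball y \<rho>|lebesgue. pos_part (u x - k) powr p) / \<Theta>) powr (1 + \<beta>)"
proof -
  define n where "n = real DIM('a)"
  have n: "0 < n" by (simp add: n_def)
  have sp: "0 < s * p" using s p by simp
  have \<beta>: "0 < \<beta>" using n sp by (simp add: \<beta>_def n_def)
  have p0: "0 < p" using p by simp
  obtain C1 where C1: "0 < C1" and FK:
    "\<And>(w :: 'a \<Rightarrow> real) z r G.
      w \<in> borel_measurable lebesgue \<Longrightarrow> (\<And>x. 0 \<le> w x) \<Longrightarrow> 0 < r \<Longrightarrow> 0 \<le> G \<Longrightarrow>
      set_integrable lebesgue (ball z r) (\<lambda>x. w x powr p) \<Longrightarrow>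
      gagliardo_pow s p (ball z r) w \<le> ennreal G \<Longrightarrow>
      (LINT x:ball z r|lebesgue. w x powr p)
        \<le> C1 * measure lebesgue {x \<in> ball z r. 0 < w x} powr \<beta>
            * (G + r powr (- (s * p)) * (LINT x:ball z r|lebesgue. w x powr p))"
    using fractional_faber_krahn[OF s(1) p0, where 'a='a] unfolding \<beta>_def by blast
  define C where "C = C1 * (H * (2 + M) + 1)"
  have C: "0 < C" unfolding C_def using C1 H M by (intro mult_pos_pos add_nonneg_pos) auto
  show thesis
  proof (rule that[OF C])
    fix u :: "'a \<Rightarrow> real" and y R d l K r \<rho> k h \<tau> \<Theta>
    assume u: "u \<in> borel_measurable lebesgue" and R: "0 < R" and K: "0 < K" and l: "0 \<le> l"
      and r2: "R / 2 \<le> r" and r\<rho>: "r < \<rho>" and \<rho>R: "\<rho> \<le> R" and k: "0 \<le> k"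
      and \<tau>: "2 \<le> \<tau>" and gap: "R / \<tau> \<le> \<rho> - r" and hK: "K / \<tau> \<le> h"
      and int: "set_integrable lebesgue (ball y R) (\<lambda>x. \<bar>u x\<bar> powr p)"
      and cac: "caccioppoli s p d H l y r \<rho> (\<lambda>x. pos_part (u x - (k + h))) (A_plus u (k + h) y \<rho>)"
      and dK: "R powr (l + s * p) * d powr p \<le> K powr p"
      and TK: "R powr (s * p) * Tail_bar s p (\<lambda>x. pos_part (u x - (k + h))) y r powr (p - 1) \<le> M * K powr (p - 1)"
      and \<Theta>: "\<Theta> = K powr p * R powr real DIM('a)"
    have r: "0 < r" and \<rho>: "0 < \<rho>" using r2 R r\<rho> by linarith+
    have \<tau>0: "0 < \<tau>" "1 \<le> \<tau>" using \<tau> by linarith+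
    have h: "0 < h" using hK K \<tau>0 by (meson divide_pos_pos less_le_trans)
    define w where "w = (\<lambda>x. pos_part (u x - (k + h)))"
    have wm: "w \<in> borel_measurable lebesgue" unfolding w_def by (rule pos_part_measurable[OF u])
    have w0: "0 \<le> w x" for x by (simp add: w_def pos_part_def)
    define Y where "Y = (LINT x:ball y \<rho>|lebesgue. pos_part (u x - k) powr p)"
    have Y0: "0 \<le> Y" unfolding Y_def by (rule set_integral_nonneg_fun) simp
    have int\<rho>: "set_integrable lebesgue (ball y \<rho>) (\<lambda>x. \<bar>u x\<bar> powr p)"
      by (rule set_integrable_subset[OF int]) (use \<rho>R in auto)
    note tg = truncation_gap[OF u h p pos_part_powr_integrable(1)[OF u k less_imp_le[OF p0] int\<rho>], folded Y_def w_def]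
    define a where "a = measure lebesgue (A_plus u (k + h) y \<rho>)"
    have a0: "0 \<le> a" by (simp add: a_def)
    have hinv: "1 / h powr e \<le> \<tau> powr e / K powr e" if "0 \<le> e" for e
    proof -
      have "(K / \<tau>) powr e \<le> h powr e" using hK K \<tau>0 that by (intro powr_mono2) auto
      then show ?thesis using K \<tau>0 h by (simp add: powr_divide field_simps)
    qed
    have aY: "a \<le> Y * (\<tau> powr p / K powr p)"
    proof -
      have "a \<le> Y * (1 / h powr p)"
        using tg(1) p0 h by (simp add: a_def field_simps)
      also have "\<dots> \<le> Y * (\<tau> powr p / K powr p)"
        using hinv[of p] p0 Y0 by (intro mult_left_mono) auto
      finally show ?thesis .
    qed
    \<comment> \<open>Each of the three terms of the Caccioppoli inequality is at most a constant times \<open>S * P\<close>.\<close>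
    define S where "S = \<tau> powr (N + p)"
    define P where "P = R powr (- (s * p)) * Y"
    have P0: "0 \<le> P" using Y0 by (simp add: P_def)
    have N: "0 < N" using sp by (simp add: N_def add_pos_pos)
    have \<tau>S: "\<tau> powr e \<le> S" if "e \<le> N + p" for e
      unfolding S_def using \<tau>0 that by (intro powr_mono) auto
    define T1 where "T1 = \<rho> powr l * d powr p * a"
    define T2 where "T2 = \<rho> powr ((1 - s) * p) / (\<rho> - r) powr p * Lp_norm p (ball y \<rho>) w powr p"
    define T3 where "T3 = \<rho> powr N / (\<rho> - r) powr N * Lp_norm 1 (ball y \<rho>) w * Tail_bar s p w y r powr (p - 1)"
    have gapinv: "1 / (\<rho> - r) powr e \<le> \<tau> powr e / R powr e" if "0 \<le> e" for e
    proof -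
      have "(R / \<tau>) powr e \<le> (\<rho> - r) powr e" using gap R \<tau>0 that by (intro powr_mono2) auto
      then show ?thesis using R \<tau>0 r\<rho> by (simp add: powr_divide field_simps)
    qed
    have "T1 \<le> R powr l * d powr p * (Y * (\<tau> powr p / K powr p))"
      unfolding T1_def using \<rho> \<rho>R l aY a0 by (intro mult_mono mult_right_mono powr_mono2) auto
    also have "\<dots> = (R powr (l + s * p) * d powr p) * (R powr (- (s * p)) * Y * (\<tau> powr p / K powr p))"
      using R by (simp add: powr_add powr_minus field_simps)
    also have "\<dots> \<le> K powr p * (R powr (- (s * p)) * Y * (\<tau> powr p / K powr p))"
      using dK Y0 by (intro mult_right_mono) auto
    also have "\<dots> = \<tau> powr p * P" using K by (simp add: P_def)
    also have "\<dots> \<le> S * P" using \<tau>S[of p] N P0 by (intro mult_right_mono) auto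
    finally have T1: "T1 \<le> S * P" .
    have "Lp_norm p (ball y \<rho>) w powr p = (LINT x:ball y \<rho>|lebesgue. w x powr p)"
      using w0 by (simp add: Lp_norm_powr[OF p0])
    then have LpY: "Lp_norm p (ball y \<rho>) w powr p \<le> Y" using tg(2) p0 by (simp add: w_def)
    have "T2 = \<rho> powr ((1 - s) * p) * (1 / (\<rho> - r) powr p) * Lp_norm p (ball y \<rho>) w powr p"
      by (simp add: T2_def)
    also have "\<dots> \<le> R powr ((1 - s) * p) * (\<tau> powr p / R powr p) * Y"
      using gapinv[of p] p0 LpY s \<rho> \<rho>R by (intro mult_mono powr_mono2 mult_nonneg_nonneg) auto
    also have "\<dots> = (R powr ((1 - s) * p) / R powr p) * (\<tau> powr p * Y)" by simp
    also have "R powr ((1 - s) * p) / R powr p = R powr (- (s * p))"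
      by (simp add: powr_diff[symmetric] algebra_simps)
    also have "\<dots> * (\<tau> powr p * Y) = \<tau> powr p * P" by (simp add: P_def)
    also have "\<dots> \<le> S * P" using \<tau>S[of p] N P0 by (intro mult_right_mono) auto
    finally have T2: "T2 \<le> S * P" .
    define L1 where "L1 = (LINT x:ball y \<rho>|lebesgue. w x)"
    define Tb where "Tb = Tail_bar s p w y r powr (p - 1)"
    have L10: "0 \<le> L1" unfolding L1_def by (rule set_integral_nonneg_fun) (rule w0)
    have Tb: "Tb \<le> M * K powr (p - 1) * R powr (- (s * p))"
      using TK R by (simp add: Tb_def w_def powr_minus field_simps)
    have L1Y: "L1 \<le> Y * (\<tau> powr (p - 1) / K powr (p - 1))"
    proof -
      have "L1 \<le> Y * (1 / h powr (p - 1))"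
        using tg(4) h by (simp add: L1_def w_def field_simps)
      also have "\<dots> \<le> Y * (\<tau> powr (p - 1) / K powr (p - 1))"
        using hinv[of "p - 1"] p Y0 by (intro mult_left_mono) auto
      finally show ?thesis .
    qed
    have "T3 = \<rho> powr N * (1 / (\<rho> - r) powr N) * (L1 * Tb)"
      using w0 by (simp add: T3_def Lp_norm_one L1_def Tb_def)
    also have "\<dots> \<le> R powr N * (\<tau> powr N / R powr N) *
        ((Y * (\<tau> powr (p - 1) / K powr (p - 1))) * (M * K powr (p - 1) * R powr (- (s * p))))"
      using gapinv[of N] N L1Y L10 Tb \<rho> \<rho>R Y0 M
      by (intro mult_mono powr_mono2 mult_nonneg_nonneg) (auto simp: Tb_def)
    also have "\<dots> = \<tau> powr (N + (p - 1)) * (M * P)"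
      unfolding powr_add using R K by (simp add: P_def)
    also have "\<dots> \<le> S * (M * P)"
      using \<tau>S[of "N + (p - 1)"] P0 M by (intro mult_right_mono mult_nonneg_nonneg) auto
    finally have T3: "T3 \<le> M * (S * P)" by (simp add: mult_ac)
    define G where "G = H * (2 + M) * (S * P)"
    have SP: "0 \<le> S * P" using P0 by (simp add: S_def)
    have G0: "0 \<le> G" using H M SP by (simp add: G_def)
    have "H * (T1 + T2 + T3) \<le> H * ((2 + M) * (S * P))"
      using T1 T2 T3 H by (intro mult_left_mono) (auto simp: algebra_simps)
    then have "ennreal (H * (T1 + T2 + T3)) \<le> ennreal G"
      by (intro ennreal_leI) (simp add: G_def mult.assoc)
    moreover have "gagliardo_pow s p (ball y r) w \<le> ennreal (H * (T1 + T2 + T3))"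
      using cac unfolding caccioppoli_def T1_def T2_def T3_def N_def a_def w_def .
    ultimately have gag: "gagliardo_pow s p (ball y r) w \<le> ennreal G" by (rule order_trans[rotated])
    have intw: "set_integrable lebesgue (ball y \<rho>) (\<lambda>x. w x powr p)"
      using tg(3) p0 by (simp add: w_def)
    have intr: "set_integrable lebesgue (ball y r) (\<lambda>x. w x powr p)"
      by (rule set_integrable_subset[OF intw]) (use r\<rho> in auto)
    define J where "J = (LINT x:ball y r|lebesgue. w x powr p)"
    have J0: "0 \<le> J" unfolding J_def by (rule set_integral_nonneg_fun) simp
    have "J \<le> (LINT x:ball y \<rho>|lebesgue. w x powr p)"
      unfolding J_def by (rule set_integral_nonneg_mono_set[OF intw]) (use r\<rho> in auto)
    also have "\<dots> \<le> Y" using tg(2) p0 by (simp add: w_def)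
    finally have JY: "J \<le> Y" .
    have "r powr (- (s * p)) * J \<le> (R / 2) powr (- (s * p)) * Y"
      using r2 R sp JY J0 by (intro mult_mono powr_mono2') auto
    also have "(R / 2) powr (- (s * p)) = 2 powr (s * p) * R powr (- (s * p))"
      using R by (simp add: powr_divide powr_minus field_simps)
    also have "\<dots> * Y = 2 powr (s * p) * P" by (simp add: P_def)
    also have "\<dots> \<le> S * P"
    proof (rule mult_right_mono[OF _ P0])
      have "2 powr (s * p) \<le> \<tau> powr (s * p)" using \<tau> sp by (intro powr_mono2) auto
      also have "\<dots> \<le> S" using p0 by (intro \<tau>S) (simp add: N_def)
      finally show "2 powr (s * p) \<le> S" .
    qed
    finally have low: "r powr (- (s * p)) * J \<le> S * P" .
    have lev: "measure lebesgue {x \<in> ball y r. 0 < w x} \<le> a"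
      unfolding a_def
    proof (rule measure_mono_fmeasurable)
      show "{x \<in> ball y r. 0 < w x} \<subseteq> A_plus u (k + h) y \<rho>"
        using r\<rho> by (auto simp: A_plus_def w_def pos_part_def max_def split: if_splits)
      show "{x \<in> ball y r. 0 < w x} \<in> sets lebesgue"
        using superlevel_set_ball_lmeasurable[OF wm] by (rule fmeasurableD)
      have "A_plus u (k + h) y \<rho> = {x \<in> ball y \<rho>. k + h < u x}" by (auto simp: A_plus_def)
      then show "A_plus u (k + h) y \<rho> \<in> lmeasurable"
        using superlevel_set_ball_lmeasurable[OF u] by simp
    qed
    have "J \<le> C1 * measure lebesgue {x \<in> ball y r. 0 < w x} powr \<beta> * (G + r powr (- (s * p)) * J)"
      unfolding J_def by (rule FK[OF wm w0 r G0 intr gag])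
    also have "\<dots> \<le> C1 * (Y * (\<tau> powr p / K powr p)) powr \<beta> * (G + S * P)"
    proof (rule mult_mono)
      show "C1 * measure lebesgue {x \<in> ball y r. 0 < w x} powr \<beta>
          \<le> C1 * (Y * (\<tau> powr p / K powr p)) powr \<beta>"
        using C1 lev aY \<beta> by (intro mult_left_mono powr_mono2) auto
    qed (use C1 low G0 J0 in auto)
    also have "\<dots> = C * (Y * (\<tau> powr p / K powr p)) powr \<beta> * (S * P)"
      by (simp add: C_def G_def algebra_simps)
    finally have main: "J \<le> C * (Y * (\<tau> powr p / K powr p)) powr \<beta> * (S * P)" .
    have \<Theta>0: "0 < \<Theta>" using \<Theta> K R by simp
    define q where "q = Y / \<Theta>"
    have q0: "0 \<le> q" using Y0 \<Theta>0 by (simp add: q_def)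
    \<comment> \<open>The powers of the radius cancel because \<open>n \<beta> = s p\<close>.\<close>
    have "Y * (\<tau> powr p / K powr p) = q * \<tau> powr p * R powr n"
      using K R by (simp add: q_def \<Theta> n_def field_simps)
    then have "(Y * (\<tau> powr p / K powr p)) powr \<beta> = q powr \<beta> * \<tau> powr (p * \<beta>) * R powr (n * \<beta>)"
      using q0 \<tau>0 R by (simp add: powr_mult powr_powr)
    moreover have "n * \<beta> = s * p" using n by (simp add: \<beta>_def n_def)
    ultimately have "J \<le> C * (q powr \<beta> * \<tau> powr (p * \<beta>) * R powr (s * p)) * (S * (R powr (- (s * p)) * Y))"
      using main by (simp add: P_def)
    also have "\<dots> = C * (\<tau> powr (p * \<beta>) * S) * q powr \<beta> * Y"
      using R by (simp add: powr_minus)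
    also have "\<tau> powr (p * \<beta>) * S = \<tau> powr (N + p + p * \<beta>)"
      by (simp add: S_def powr_add)
    finally have "J / \<Theta> \<le> C * \<tau> powr (N + p + p * \<beta>) * q powr \<beta> * Y / \<Theta>"
      using \<Theta>0 by (simp add: divide_right_mono)
    also have "\<dots> = C * \<tau> powr (N + p + p * \<beta>) * (q powr \<beta> * q)" by (simp add: q_def)
    also have "q powr \<beta> * q = q powr (1 + \<beta>)"
      using q0 by (simp add: powr_add)
    finally show "(LINT x:ball y r|lebesgue. pos_part (u x - (k + h)) powr p) / \<Theta>
       \<le> C * \<tau> powr (N + p + p * \<beta>)
          * ((LINT x:ball y \<rho>|lebesgue. pos_part (u x - k) powr p) / \<Theta>) powr (1 + \<beta>)"
      by (simp add: J_def q_def Y_def w_def)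
  qed
qed

section \<open>The tail\<close>

text \<open>Away from \<open>y\<close> the kernels \<open>|x - y|\<^bsup>-n-sp\<^esup>\<close> and \<open>(1 + |x|)\<^bsup>-n-sp\<^esup>\<close> are comparable.\<close>

lemma tail_kernel_integrable:
  fixes u :: "'a::euclidean_space \<Rightarrow> real"
  assumes u: "u \<in> tail_space s p" and s: "0 < s" and p: "1 < p" and r: "0 < r"
  shows "set_integrable lebesgue (- ball y r)
     (\<lambda>x. \<bar>u x\<bar> powr (p - 1) / norm (x - y) powr (real DIM('a) + s * p))"
proof -
  define N where "N = real DIM('a) + s * p"
  have N: "0 < N" using s p by (simp add: N_def add_pos_pos)
  have um: "u \<in> borel_measurable lebesgue"
    and int: "integrable lebesgue (\<lambda>x. \<bar>u x\<bar> powr (p - 1) / (1 + norm x) powr N)"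
    using u by (auto simp: tail_space_def N_def)
  define c where "c = 1 + (1 + norm y) / r"
  have c: "0 < c" using r by (simp add: c_def add_pos_nonneg)
  have m: "(\<lambda>x. \<bar>u x\<bar> powr (p - 1) / norm (x - y) powr N) \<in> borel_measurable lebesgue"
  proof -
    have "(\<lambda>x. norm (x - y) powr N) \<in> borel_measurable lebesgue"
      by (rule measurable_completion) measurable
    then show ?thesis using um by measurable
  qed
  have intc: "set_integrable lebesgue (- ball y r) (\<lambda>x. c powr N * (\<bar>u x\<bar> powr (p - 1) / (1 + norm x) powr N))"
    unfolding set_integrable_def
    by (rule integrable_mult_indicator[OF _ integrable_mult_right[OF int]]) simp
  show ?thesis unfolding N_def[symmetric]
  proof (rule set_integral_dominated(1)[OF _ m intc])
    fix x assume "x \<in> - ball y r"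
    then have x: "r \<le> norm (x - y)" by (simp add: dist_norm norm_minus_commute)
    have "(1 + norm y) / r * r \<le> (1 + norm y) / r * norm (x - y)"
      using x r by (intro mult_left_mono) auto
    then have "1 + norm y \<le> (1 + norm y) / r * norm (x - y)"
      using r by simp
    moreover have "norm x \<le> norm y + norm (x - y)"
      using norm_triangle_ineq[of y "x - y"] by simp
    ultimately have "1 + norm x \<le> c * norm (x - y)"
      by (simp add: c_def distrib_right)
    then have "(1 + norm x) powr N \<le> (c * norm (x - y)) powr N"
      using N by (intro powr_mono2) auto
    then have le: "(1 + norm x) powr N \<le> c powr N * norm (x - y) powr N"
      by (simp add: powr_mult)
    have "x \<noteq> y" using x r by auto
    then have n0: "0 < norm (x - y) powr N" by simp
    have "0 < 1 + norm x" by (simp add: add_pos_nonneg)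
    then have x0: "0 < (1 + norm x) powr N" by simp
    have "1 / norm (x - y) powr N \<le> c powr N / (1 + norm x) powr N"
      using le n0 x0 by (simp add: field_simps)
    then have "\<bar>u x\<bar> powr (p - 1) * (1 / norm (x - y) powr N)
       \<le> \<bar>u x\<bar> powr (p - 1) * (c powr N / (1 + norm x) powr N)"
      by (intro mult_left_mono) auto
    then show "0 \<le> \<bar>u x\<bar> powr (p - 1) / norm (x - y) powr N \<and>
        \<bar>u x\<bar> powr (p - 1) / norm (x - y) powr N
        \<le> c powr N * (\<bar>u x\<bar> powr (p - 1) / (1 + norm x) powr N)"
      by (simp add: mult_ac)
  qed simp
qed

lemma Tail_bar_pos_part_le:
  fixes u :: "'a::euclidean_space \<Rightarrow> real"
  assumes u: "u \<in> tail_space s p" and s: "0 < s" and p: "1 < p" and r: "0 < r" "r \<le> r'" and k: "0 \<le> k"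
  shows "Tail_bar s p (\<lambda>x. pos_part (u x - k)) y r' powr (p - 1) \<le> Tail_bar s p u y r powr (p - 1)"
proof -
  define N where "N = real DIM('a) + s * p"
  have um: "u \<in> borel_measurable lebesgue" using u by (simp add: tail_space_def)
  have r': "0 < r'" using r by simp
  note int = tail_kernel_integrable[OF u s p r(1), of y, folded N_def]
  have int': "set_integrable lebesgue (- ball y r') (\<lambda>x. \<bar>u x\<bar> powr (p - 1) / norm (x - y) powr N)"
    by (rule set_integrable_subset[OF int]) (use r in auto)
  have m: "(\<lambda>x. \<bar>pos_part (u x - k)\<bar> powr (p - 1) / norm (x - y) powr N) \<in> borel_measurable lebesgue"
  proof -
    have "(\<lambda>x. norm (x - y) powr N) \<in> borel_measurable lebesgue"
      by (rule measurable_completion) measurable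
    then show ?thesis using pos_part_measurable[OF um, of k] by measurable
  qed
  have "(LINT x:- ball y r'|lebesgue. \<bar>pos_part (u x - k)\<bar> powr (p - 1) / norm (x - y) powr N)
      \<le> (LINT x:- ball y r'|lebesgue. \<bar>u x\<bar> powr (p - 1) / norm (x - y) powr N)"
    by (rule set_integral_dominated(2)[OF _ m int'])
      (use p k in \<open>auto simp: pos_part_def intro!: divide_right_mono powr_mono2\<close>)
  also have "\<dots> \<le> (LINT x:- ball y r|lebesgue. \<bar>u x\<bar> powr (p - 1) / norm (x - y) powr N)"
    by (rule set_integral_nonneg_mono_set[OF int]) (use r in auto)
  finally show ?thesis
    using p r r' by (simp add: Tail_bar_powr N_def)
qed

text \<open>Far from \<open>x0\<close> the distances to \<open>x0\<close> and to \<open>y\<close> are comparable, so the tail about \<open>x0\<close> takes over. The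
  remaining part, over \<open>ball x0 (2 * R)\<close>, is local: the bound \<open>|u|\<^bsup>p-1\<^esup> \<le> K\<^bsup>p-1\<^esup> + |u|\<^sup>p / K\<close>
  takes the place of Hoelder's inequality in reducing it to the \<open>L\<^sup>p\<close> mean.\<close>

lemma Tail_bar_recentre:
  fixes u :: "'a::euclidean_space \<Rightarrow> real"
  assumes u: "u \<in> tail_space s p" and s: "0 < s" and p: "1 < p" and R: "0 < R" and K: "0 < K"
    and y: "y \<in> ball x0 R"
    and int: "set_integrable lebesgue (ball x0 (2 * R)) (\<lambda>x. \<bar>u x\<bar> powr p)"
    and avg: "(LINT x:ball x0 (2 * R)|lebesgue. \<bar>u x\<bar> powr p) \<le> K powr p * R powr real DIM('a)"
    and tail: "Tail s p u x0 R \<le> K"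
  shows "R powr (s * p) * Tail_bar s p u y (R / 2) powr (p - 1)
     \<le> 2 powr (real DIM('a) + s * p) * (unit_ball_vol (real DIM('a)) * 2 ^ DIM('a) + 2) * K powr (p - 1)"
proof -
  define n where "n = real DIM('a)"
  define N where "N = n + s * p"
  define v where "v = unit_ball_vol n"
  have N: "0 < N" using s p by (simp add: N_def n_def add_pos_pos)
  have v0: "0 \<le> v" by (simp add: v_def n_def)
  define B where "B = ball x0 (2 * R)"
  define I where "I = (LINT x:B|lebesgue. \<bar>u x\<bar> powr p)"
  define f where "f = (\<lambda>z x. \<bar>u x\<bar> powr (p - 1) / norm (x - z) powr N)"
  define g where "g = (\<lambda>x. (2 / R) powr N * (K powr (p - 1) + \<bar>u x\<bar> powr p / K))"
  have fint: "set_integrable lebesgue (- ball z r) (f z)" if "0 < r" for z r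
    unfolding f_def N_def n_def by (rule tail_kernel_integrable[OF u s p that])
  have f0: "0 \<le> f z x" for z x by (simp add: f_def)
  have intK: "set_integrable lebesgue B (\<lambda>x. \<bar>u x\<bar> powr p / K)"
    using int unfolding B_def by (intro set_integrable_divide)
  have constK: "set_integrable lebesgue B (\<lambda>x. K powr (p - 1))"
    unfolding B_def by (rule set_integral_const_ball)
  have gint: "set_integrable lebesgue B g"
    unfolding g_def by (intro set_integrable_mult_right set_integral_add(1) intK constK)
  have g0: "0 \<le> g x" for x using K by (simp add: g_def)
  have pt: "indicator (- ball y (R / 2)) x *\<^sub>R f y x
     \<le> indicator B x *\<^sub>R g x + 2 powr N * (indicator (- ball x0 R) x *\<^sub>R f x0 x)" for x
  proof (cases "x \<in> - ball y (R / 2)")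
    case False
    then show ?thesis using f0 g0 by (simp add: indicator_def)
  next
    case True
    then have d: "R / 2 \<le> norm (x - y)" by (simp add: dist_norm norm_minus_commute)
    show ?thesis
    proof (cases "x \<in> B")
      case xB: True
      have small: "\<bar>u x\<bar> powr (p - 1) \<le> K powr (p - 1) + \<bar>u x\<bar> powr p / K"
      proof (cases "\<bar>u x\<bar> \<le> K")
        case True
        then have "\<bar>u x\<bar> powr (p - 1) \<le> K powr (p - 1)" using p by (intro powr_mono2) auto
        then show ?thesis using K by (simp add: add_increasing2)
      next
        case False
        then have "\<bar>u x\<bar> powr (p - 1) = \<bar>u x\<bar> powr p / \<bar>u x\<bar>"
          using K by (simp add: powr_diff)
        also have "\<dots> \<le> \<bar>u x\<bar> powr p / K"
          using False K by (intro divide_left_mono) (auto intro!: mult_pos_pos)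
        finally show ?thesis by (simp add: add_increasing)
      qed
      have "(R / 2) powr N \<le> norm (x - y) powr N" using d R N by (intro powr_mono2) auto
      moreover have "0 < (R / 2) powr N" using R by simp
      ultimately have "f y x \<le> \<bar>u x\<bar> powr (p - 1) / (R / 2) powr N"
        unfolding f_def by (intro divide_left_mono) (auto intro!: mult_pos_pos)
      also have "\<dots> = (2 / R) powr N * \<bar>u x\<bar> powr (p - 1)"
        using R by (simp add: powr_divide)
      also have "\<dots> \<le> g x"
        unfolding g_def using small by (intro mult_left_mono) auto
      finally show ?thesis using True xB f0[of x0 x] by (simp add: indicator_def add_increasing2)
    next
      case xB: False
      then have dx: "2 * R \<le> norm (x - x0)" by (simp add: B_def dist_norm norm_minus_commute)
      have yR: "norm (y - x0) < R" using y by (simp add: dist_norm norm_minus_commute)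
      have "norm (x - x0) \<le> norm (x - y) + norm (y - x0)"
        using norm_triangle_ineq[of "x - y" "y - x0"] by simp
      with dx yR have "norm (x - x0) \<le> 2 * norm (x - y)" by linarith
      then have "norm (x - x0) powr N \<le> (2 * norm (x - y)) powr N"
        using N by (intro powr_mono2) auto
      then have le: "norm (x - x0) powr N \<le> 2 powr N * norm (x - y) powr N"
        by (simp add: powr_mult)
      have "0 < norm (x - x0) powr N" "0 < norm (x - y) powr N" using dx d R by auto
      then have "1 / norm (x - y) powr N \<le> 2 powr N / norm (x - x0) powr N"
        using le by (simp add: field_simps)
      then have "\<bar>u x\<bar> powr (p - 1) * (1 / norm (x - y) powr N)
         \<le> \<bar>u x\<bar> powr (p - 1) * (2 powr N / norm (x - x0) powr N)"
        by (intro mult_left_mono) auto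
      then have "f y x \<le> 2 powr N * f x0 x" by (simp add: f_def mult_ac)
      moreover have "x \<in> - ball x0 R" using dx R by (simp add: dist_norm norm_minus_commute)
      ultimately show ?thesis using True xB by simp
    qed
  qed
  have "(LINT x:- ball y (R / 2)|lebesgue. f y x)
      \<le> (\<integral>x. indicator B x *\<^sub>R g x + 2 powr N * (indicator (- ball x0 R) x *\<^sub>R f x0 x) \<partial>lebesgue)"
    unfolding set_lebesgue_integral_def
    using fint[of "R / 2" y] fint[of R x0] gint R pt
    by (intro integral_mono Bochner_Integration.integrable_add integrable_mult_right)
      (auto simp: set_integrable_def)
  also have "\<dots> = (LINT x:B|lebesgue. g x) + 2 powr N * (LINT x:- ball x0 R|lebesgue. f x0 x)"
    unfolding set_lebesgue_integral_def
    using fint[of R x0] gint R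
    by (subst Bochner_Integration.integral_add) (auto simp: set_integrable_def)
  also have "(LINT x:B|lebesgue. g x) = (2 / R) powr N * (K powr (p - 1) * measure lebesgue B + I / K)"
    unfolding g_def using intK constK
    by (simp add: set_integral_add(2) I_def B_def set_integral_const_ball(2))
  finally have T: "Tail_bar s p u y (R / 2) powr (p - 1) \<le>
      (2 / R) powr N * (K powr (p - 1) * measure lebesgue B + I / K)
      + 2 powr N * (LINT x:- ball x0 R|lebesgue. f x0 x)"
    using p R by (simp add: Tail_bar_powr f_def N_def n_def)
  have Tx0: "R powr (s * p) * (LINT x:- ball x0 R|lebesgue. f x0 x) \<le> K powr (p - 1)"
  proof -
    have "Tail s p u x0 R powr (p - 1) \<le> K powr (p - 1)"
      using tail p by (intro powr_mono2) (auto simp: Tail_def)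
    then show ?thesis by (simp add: Tail_powr[OF p] f_def N_def n_def)
  qed
  have mB: "measure lebesgue B = v * 2 ^ DIM('a) * R powr n"
    using R by (simp add: B_def content_ball v_def n_def powr_realpow power_mult_distrib)
  have IK: "I / K \<le> K powr (p - 1) * R powr n"
    using avg K by (simp add: I_def B_def n_def powr_diff field_simps)
  have "K powr (p - 1) * measure lebesgue B + I / K \<le> K powr (p - 1) * R powr n * (v * 2 ^ DIM('a) + 1)"
    using IK by (simp add: mB algebra_simps)
  then have "(2 / R) powr N * (K powr (p - 1) * measure lebesgue B + I / K)
     \<le> (2 / R) powr N * (K powr (p - 1) * R powr n * (v * 2 ^ DIM('a) + 1))"
    by (intro mult_left_mono) auto
  with T have "Tail_bar s p u y (R / 2) powr (p - 1)
      \<le> (2 / R) powr N * (K powr (p - 1) * R powr n * (v * 2 ^ DIM('a) + 1))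
      + 2 powr N * (LINT x:- ball x0 R|lebesgue. f x0 x)" by linarith
  then have "R powr (s * p) * Tail_bar s p u y (R / 2) powr (p - 1)
      \<le> R powr (s * p) * ((2 / R) powr N * (K powr (p - 1) * R powr n * (v * 2 ^ DIM('a) + 1))
      + 2 powr N * (LINT x:- ball x0 R|lebesgue. f x0 x))"
    by (intro mult_left_mono) auto
  also have "\<dots> = R powr (s * p) * (2 / R) powr N * R powr n * (K powr (p - 1) * (v * 2 ^ DIM('a) + 1))
      + 2 powr N * (R powr (s * p) * (LINT x:- ball x0 R|lebesgue. f x0 x))"
    by (simp add: algebra_simps)
  also have "R powr (s * p) * (2 / R) powr N * R powr n = 2 powr N"
    using R by (simp add: powr_divide N_def powr_add)
  also have "2 powr N * (K powr (p - 1) * (v * 2 ^ DIM('a) + 1))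
      + 2 powr N * (R powr (s * p) * (LINT x:- ball x0 R|lebesgue. f x0 x))
     \<le> 2 powr N * (K powr (p - 1) * (v * 2 ^ DIM('a) + 1)) + 2 powr N * K powr (p - 1)"
    using Tx0 by (intro add_left_mono mult_left_mono) auto
  also have "\<dots> = 2 powr N * (v * 2 ^ DIM('a) + 2) * K powr (p - 1)"
    by (simp add: algebra_simps)
  finally show ?thesis by (simp add: N_def n_def v_def)
qed

section \<open>Local boundedness\<close>

text \<open>The threshold \<open>\<delta>\<close> is that of \<open>fast_geometric_convergence\<close>. It depends on the tail constant \<open>M\<close>,
  which therefore has to be given in advance; the bound \<open>\<delta> \<le> 1\<close> allows \<open>M\<close> to be chosen without
  knowing \<open>\<delta>\<close>.\<close>

lemma local_upper_bound:
  fixes s p H M :: real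
  assumes s: "0 < s" "s < 1" and p: "1 < p" and H: "1 \<le> H" and M: "0 \<le> M"
  obtains \<delta> where "0 < \<delta>" "\<delta> \<le> 1"
    "\<And>(u :: 'a::euclidean_space \<Rightarrow> real) y R d l K.
      u \<in> tail_space s p \<Longrightarrow> 0 < R \<Longrightarrow> 0 < K \<Longrightarrow> 0 \<le> l \<Longrightarrow>
      set_integrable lebesgue (ball y R) (\<lambda>x. \<bar>u x\<bar> powr p) \<Longrightarrow>
      (\<And>r \<rho> k. 0 < r \<Longrightarrow> r < \<rho> \<Longrightarrow> \<rho> \<le> R \<Longrightarrow>
        caccioppoli s p d H l y r \<rho> (\<lambda>x. pos_part (u x - k)) (A_plus u k y \<rho>)) \<Longrightarrow>
      R powr (l + s * p) * d powr p \<le> K powr p \<Longrightarrow>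
      R powr (s * p) * Tail_bar s p u y (R / 2) powr (p - 1) \<le> M * K powr (p - 1) \<Longrightarrow>
      (LINT x:ball y R|lebesgue. \<bar>u x\<bar> powr p) \<le> \<delta> * (K powr p * R powr real DIM('a)) \<Longrightarrow>
      AE x in lebesgue. x \<in> ball y (R / 2) \<longrightarrow> u x \<le> K"
proof -
  define N where "N = real DIM('a) + s * p"
  define \<beta> where "\<beta> = s * p / real DIM('a)"
  have sp: "0 < s * p" using s p by simp
  have N: "0 < N" using sp by (simp add: N_def add_pos_pos)
  have \<beta>: "0 < \<beta>" using sp by (simp add: \<beta>_def)
  define E where "E = N + p + p * \<beta>"
  have E: "0 < E" using N p \<beta> by (simp add: E_def add_pos_pos)
  obtain C where C: "0 < C" and step:
    "\<And>(u :: 'a \<Rightarrow> real) y R d l K r \<rho> k h \<tau> \<Theta>.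
      u \<in> borel_measurable lebesgue \<Longrightarrow> 0 < R \<Longrightarrow> 0 < K \<Longrightarrow> 0 \<le> l \<Longrightarrow>
      R / 2 \<le> r \<Longrightarrow> r < \<rho> \<Longrightarrow> \<rho> \<le> R \<Longrightarrow> 0 \<le> k \<Longrightarrow>
      2 \<le> \<tau> \<Longrightarrow> R / \<tau> \<le> \<rho> - r \<Longrightarrow> K / \<tau> \<le> h \<Longrightarrow>
      set_integrable lebesgue (ball y R) (\<lambda>x. \<bar>u x\<bar> powr p) \<Longrightarrow>
      caccioppoli s p d H l y r \<rho> (\<lambda>x. pos_part (u x - (k + h))) (A_plus u (k + h) y \<rho>) \<Longrightarrow>
      R powr (l + s * p) * d powr p \<le> K powr p \<Longrightarrow>
      R powr (s * p) * Tail_bar s p (\<lambda>x. pos_part (u x - (k + h))) y r powr (p - 1) \<le> M * K powr (p - 1) \<Longrightarrow>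
      \<Theta> = K powr p * R powr real DIM('a) \<Longrightarrow>
      (LINT x:ball y r|lebesgue. pos_part (u x - (k + h)) powr p) / \<Theta>
       \<le> C * \<tau> powr E
          * ((LINT x:ball y \<rho>|lebesgue. pos_part (u x - k) powr p) / \<Theta>) powr (1 + \<beta>)"
    using de_giorgi_step[OF s p H M, where 'a='a] unfolding E_def N_def \<beta>_def by blast
  define C' where "C' = C * 4 powr E"
  define b where "b = (2::real) powr E"
  have C': "0 < C'" using C by (simp add: C'_def)
  have b: "1 < b" using E by (simp add: b_def)
  define \<delta> where "\<delta> = min 1 (C' powr (- 1 / \<beta>) * b powr (- 1 / \<beta>\<^sup>2))"
  show thesis
  proof (rule that[of \<delta>])
    show "0 < \<delta>" using C' b by (simp add: \<delta>_def)
    show "\<delta> \<le> 1" by (simp add: \<delta>_def)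
    fix u :: "'a \<Rightarrow> real" and y R d l K
    assume u: "u \<in> tail_space s p" and R: "0 < R" and K: "0 < K" and l: "0 \<le> l"
      and int: "set_integrable lebesgue (ball y R) (\<lambda>x. \<bar>u x\<bar> powr p)"
      and cac: "\<And>r \<rho> k. 0 < r \<Longrightarrow> r < \<rho> \<Longrightarrow> \<rho> \<le> R \<Longrightarrow>
        caccioppoli s p d H l y r \<rho> (\<lambda>x. pos_part (u x - k)) (A_plus u k y \<rho>)"
      and dK: "R powr (l + s * p) * d powr p \<le> K powr p"
      and TK: "R powr (s * p) * Tail_bar s p u y (R / 2) powr (p - 1) \<le> M * K powr (p - 1)"
      and small: "(LINT x:ball y R|lebesgue. \<bar>u x\<bar> powr p) \<le> \<delta> * (K powr p * R powr real DIM('a))"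
    have um: "u \<in> borel_measurable lebesgue" using u by (simp add: tail_space_def)
    have p0: "0 \<le> p" using p by simp
    define \<Theta> where "\<Theta> = K powr p * R powr real DIM('a)"
    have \<Theta>: "0 < \<Theta>" using K R by (simp add: \<Theta>_def)
    define \<rho> where "\<rho> = (\<lambda>j::nat. R / 2 * (1 + 1 / 2 ^ j))"
    define \<kappa> where "\<kappa> = (\<lambda>j::nat. K * (1 - 1 / 2 ^ j))"
    define q where "q = (\<lambda>j. (LINT x:ball y (\<rho> j)|lebesgue. pos_part (u x - \<kappa> j) powr p) / \<Theta>)"
    have q0: "0 \<le> q j" for j
      unfolding q_def using \<Theta> by (intro divide_nonneg_pos set_integral_nonneg_fun) auto
    have \<rho>R: "R / 2 < \<rho> j" "\<rho> j \<le> R" for j using R by (auto simp: \<rho>_def)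
    have \<kappa>K: "0 \<le> \<kappa> j" "\<kappa> j \<le> K" for j using K by (auto simp: \<kappa>_def field_simps)
    have rec: "q (Suc j) \<le> C' * b powr real j * q j powr (1 + \<beta>)" for j
    proof -
      define h where "h = K / 2 ^ Suc j"
      \<comment> \<open>The radii shrink by \<open>R / 2\<^bsup>j+2\<^esup>\<close> and the levels rise by \<open>K / 2\<^bsup>j+1\<^esup>\<close>; the smaller ratio decides.\<close>
      define \<tau> :: real where "\<tau> = 4 * 2 ^ j"
      have \<kappa>h: "\<kappa> (Suc j) = \<kappa> j + h" by (simp add: \<kappa>_def h_def field_simps)
      have gap: "\<rho> j - \<rho> (Suc j) = R / \<tau>" by (simp add: \<rho>_def \<tau>_def field_simps)
      have \<tau>: "2 \<le> \<tau>" using one_le_power[of "2::real" j] unfolding \<tau>_def by linarith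
      have \<rho>less: "\<rho> (Suc j) < \<rho> j"
        using R unfolding \<rho>_def by (intro mult_strict_left_mono add_strict_left_mono divide_strict_left_mono) auto
      have "R powr (s * p) * Tail_bar s p (\<lambda>x. pos_part (u x - \<kappa> (Suc j))) y (\<rho> (Suc j)) powr (p - 1)
          \<le> R powr (s * p) * Tail_bar s p u y (R / 2) powr (p - 1)"
        using R \<rho>R[of "Suc j"] \<kappa>K[of "Suc j"]
        by (intro mult_left_mono Tail_bar_pos_part_le[OF u s(1) p]) auto
      also note TK
      finally have tailj: "R powr (s * p) *
          Tail_bar s p (\<lambda>x. pos_part (u x - (\<kappa> j + h))) y (\<rho> (Suc j)) powr (p - 1) \<le> M * K powr (p - 1)"
        by (simp only: \<kappa>h)
      have "q (Suc j) \<le> C * \<tau> powr E * q j powr (1 + \<beta>)"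
        unfolding q_def \<kappa>h
      proof (rule step[OF um R K l _ \<rho>less _ _ \<tau> _ _ int _ dK tailj \<Theta>_def])
        show "K / \<tau> \<le> h" using K by (simp add: h_def \<tau>_def field_simps)
        show "caccioppoli s p d H l y (\<rho> (Suc j)) (\<rho> j) (\<lambda>x. pos_part (u x - (\<kappa> j + h))) (A_plus u (\<kappa> j + h) y (\<rho> j))"
          using R \<rho>R[of "Suc j"] \<rho>R[of j] \<rho>less by (intro cac) auto
      qed (use \<rho>R[of "Suc j"] \<rho>R[of j] \<kappa>K[of j] gap in auto)
      also have "C * \<tau> powr E = C' * b powr real j"
        by (simp add: \<tau>_def C'_def b_def powr_mult powr_powr powr_realpow[symmetric] mult.commute)
      finally show ?thesis .
    qed
    have "q 0 \<le> \<delta>"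
    proof -
      have "(LINT x:ball y R|lebesgue. pos_part (u x - 0) powr p) \<le> (LINT x:ball y R|lebesgue. \<bar>u x\<bar> powr p)"
        by (rule pos_part_powr_integrable(2)[OF um _ p0 int]) simp
      also note small
      finally show ?thesis using \<Theta> by (simp add: q_def \<rho>_def \<kappa>_def \<Theta>_def divide_le_eq)
    qed
    then have "q \<longlonglongrightarrow> 0"
      using fast_geometric_convergence[OF C' b \<beta> q0 rec] by (simp add: \<delta>_def)
    define J where "J = (LINT x:ball y (R / 2)|lebesgue. pos_part (u x - K) powr p)"
    have ball_int: "set_integrable lebesgue (ball y (\<rho> j)) (\<lambda>x. \<bar>u x\<bar> powr p)" for j
      by (rule set_integrable_subset[OF int]) (use \<rho>R(2)[of j] in auto)
    have "set_integrable lebesgue (ball y (R / 2)) (\<lambda>x. \<bar>u x\<bar> powr p)"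
      by (rule set_integrable_subset[OF int]) (use R in auto)
    then have Jint: "set_integrable lebesgue (ball y (R / 2)) (\<lambda>x. pos_part (u x - K) powr p)"
      using K p0 by (intro pos_part_powr_integrable(1)[OF um]) auto
    have "J \<le> \<Theta> * q j" for j
    proof -
      have i1: "set_integrable lebesgue (ball y (\<rho> j)) (\<lambda>x. pos_part (u x - \<kappa> j) powr p)"
        by (rule pos_part_powr_integrable(1)[OF um \<kappa>K(1) p0 ball_int])
      have i2: "set_integrable lebesgue (ball y (\<rho> j)) (\<lambda>x. pos_part (u x - K) powr p)"
        using K by (intro pos_part_powr_integrable(1)[OF um _ p0 ball_int]) auto
      have "J \<le> (LINT x:ball y (\<rho> j)|lebesgue. pos_part (u x - K) powr p)"
        unfolding J_def by (rule set_integral_nonneg_mono_set[OF i2]) (use \<rho>R[of j] in auto)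
      also have "\<dots> \<le> (LINT x:ball y (\<rho> j)|lebesgue. pos_part (u x - \<kappa> j) powr p)"
        by (rule set_integral_mono[OF i2 i1])
          (use \<kappa>K[of j] p0 in \<open>auto simp: pos_part_def intro!: powr_mono2\<close>)
      also have "\<dots> = \<Theta> * q j" using \<Theta> by (simp add: q_def)
      finally show ?thesis .
    qed
    moreover have "(\<lambda>j. \<Theta> * q j) \<longlonglongrightarrow> 0"
      using \<open>q \<longlonglongrightarrow> 0\<close> by (rule tendsto_mult_right_zero)
    ultimately have "J \<le> 0"
      by (intro LIMSEQ_le_const[where X="\<lambda>j. \<Theta> * q j"]) auto
    moreover have "0 \<le> J" unfolding J_def by (rule set_integral_nonneg_fun) simp
    ultimately have "J = 0" by simp
    then have "AE x in lebesgue. indicator (ball y (R / 2)) x *\<^sub>R pos_part (u x - K) powr p = 0"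
      unfolding J_def set_lebesgue_integral_def
      using Jint by (subst (asm) integral_nonneg_eq_0_iff_AE) (auto simp: set_integrable_def)
    then show "AE x in lebesgue. x \<in> ball y (R / 2) \<longrightarrow> u x \<le> K"
      by eventually_elim (auto simp: pos_part_def indicator_def max_def split: if_splits)
  qed
qed

lemma weak_DG_minus_uminus:
  fixes u :: "'a::euclidean_space \<Rightarrow> real"
  assumes "u \<in> weak_DG_minus s p \<Omega> d H l"
  shows "(\<lambda>x. - u x) \<in> weak_DG_plus s p \<Omega> d H l"
proof -
  have w: "(\<lambda>x. pos_part (- u x - k)) = (\<lambda>x. neg_part (u x - (- k)))" for k
    by (simp add: pos_part_def neg_part_def fun_eq_iff)
  have A: "A_plus (\<lambda>x. - u x) k = A_minus u (- k)" for k
    by (auto simp: A_plus_def A_minus_def fun_eq_iff)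
  have "\<bar>- u x + u y\<bar> = \<bar>u x - u y\<bar>" for x y by simp
  then have gag: "gagliardo_pow s p \<Omega> (\<lambda>x. - u x) = gagliardo_pow s p \<Omega> u"
    by (simp add: gagliardo_pow_def)
  have "caccioppoli s p d H l x0 r R (\<lambda>x. pos_part (- u x - k)) (A_plus (\<lambda>x. - u x) k x0 R)"
    if "x0 \<in> \<Omega>" "0 < r" "r < R" "R < infdist x0 (frontier \<Omega>)" for x0 r R k
    unfolding w A using assms that by (simp add: weak_DG_minus_def del: diff_minus_eq_add)
  moreover have "(\<lambda>x. - u x) \<in> tail_space s p \<inter> frac_sobolev s p \<Omega>"
    using assms gag by (auto simp: weak_DG_minus_def tail_space_def frac_sobolev_def Lp_space_def)
  ultimately show ?thesis by (simp add: weak_DG_plus_def)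
qed

text \<open>A ball is connected, so it cannot leave \<open>\<Omega>\<close> without meeting the frontier.\<close>

lemma ball_infdist_frontier_subset:
  fixes x :: "'a::euclidean_space"
  assumes "x \<in> \<Omega>" and "R \<le> infdist x (frontier \<Omega>)"
  shows "ball x R \<subseteq> \<Omega>"
proof (cases "0 < R")
  case R: True
  show ?thesis
  proof (rule ccontr)
    assume "\<not> ball x R \<subseteq> \<Omega>"
    moreover have "x \<in> ball x R \<inter> \<Omega>" using R assms by simp
    ultimately have "ball x R \<inter> frontier \<Omega> \<noteq> {}"
      using connected_Int_frontier[OF connected_ball] by blast
    then obtain z where "dist x z < R" "z \<in> frontier \<Omega>" by auto
    then show False using infdist_le[of z "frontier \<Omega>" x] assms by simp
  qed
qed (simp add: ball_empty)

lemma infdist_frontier_pos: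
  fixes x :: "'a::euclidean_space"
  assumes "open \<Omega>" "bounded \<Omega>" "x \<in> \<Omega>"
  shows "0 < infdist x (frontier \<Omega>)"
proof -
  have "frontier \<Omega> \<noteq> {}"
    using assms not_bounded_UNIV by (auto simp: frontier_eq_empty)
  moreover have "x \<notin> frontier \<Omega>" using assms by (simp add: frontier_def interior_open)
  ultimately show ?thesis by (simp add: infdist_pos_not_in_closed)
qed

text \<open>The balls \<open>ball y R\<close> with \<open>y \<in> ball x0 R\<close> lie in \<open>ball x0 (2 * R)\<close> and keep away from the frontier,
  so \<open>local_upper_bound\<close> applies on each of them; the Lindelof property reduces the cover by half
  balls to a countable one, as exceptional null sets require.\<close>

lemma sup_bound_ball:
  fixes s p H :: real
  assumes s: "0 < s" "s < 1" and p: "1 < p" and H: "1 \<le> H"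
  obtains \<delta> where "0 < \<delta>"
    "\<And>(u :: 'a::euclidean_space \<Rightarrow> real) \<Omega> x0 R d l K.
      u \<in> weak_DG_plus s p \<Omega> d H l \<Longrightarrow> 0 \<le> l \<Longrightarrow> x0 \<in> \<Omega> \<Longrightarrow>
      0 < R \<Longrightarrow> 2 * R < infdist x0 (frontier \<Omega>) \<Longrightarrow> 0 < K \<Longrightarrow>
      (LINT x:ball x0 (2 * R)|lebesgue. \<bar>u x\<bar> powr p) \<le> \<delta> * (K powr p * R powr real DIM('a)) \<Longrightarrow>
      Tail s p u x0 R \<le> K \<Longrightarrow>
      R powr (l + s * p) * d powr p \<le> K powr p \<Longrightarrow>
      AE x in lebesgue. x \<in> ball x0 R \<longrightarrow> u x \<le> K"
proof -
  define M where "M = 2 powr (real DIM('a) + s * p) * (unit_ball_vol (real DIM('a)) * 2 ^ DIM('a) + 2)"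
  have M: "0 \<le> M" by (simp add: M_def)
  obtain \<delta> where \<delta>: "0 < \<delta>" "\<delta> \<le> 1" and local:
    "\<And>(u :: 'a \<Rightarrow> real) y R d l K.
      u \<in> tail_space s p \<Longrightarrow> 0 < R \<Longrightarrow> 0 < K \<Longrightarrow> 0 \<le> l \<Longrightarrow>
      set_integrable lebesgue (ball y R) (\<lambda>x. \<bar>u x\<bar> powr p) \<Longrightarrow>
      (\<And>r \<rho> k. 0 < r \<Longrightarrow> r < \<rho> \<Longrightarrow> \<rho> \<le> R \<Longrightarrow>
        caccioppoli s p d H l y r \<rho> (\<lambda>x. pos_part (u x - k)) (A_plus u k y \<rho>)) \<Longrightarrow>
      R powr (l + s * p) * d powr p \<le> K powr p \<Longrightarrow>
      R powr (s * p) * Tail_bar s p u y (R / 2) powr (p - 1) \<le> M * K powr (p - 1) \<Longrightarrow>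
      (LINT x:ball y R|lebesgue. \<bar>u x\<bar> powr p) \<le> \<delta> * (K powr p * R powr real DIM('a)) \<Longrightarrow>
      AE x in lebesgue. x \<in> ball y (R / 2) \<longrightarrow> u x \<le> K"
    using local_upper_bound[OF s p H M, where 'a='a] by blast
  show thesis
  proof (rule that[OF \<delta>(1)])
    fix u :: "'a \<Rightarrow> real" and \<Omega> x0 R d l K
    assume u: "u \<in> weak_DG_plus s p \<Omega> d H l" and l: "0 \<le> l" and x0: "x0 \<in> \<Omega>"
      and R: "0 < R" and dist: "2 * R < infdist x0 (frontier \<Omega>)" and K: "0 < K"
      and avg: "(LINT x:ball x0 (2 * R)|lebesgue. \<bar>u x\<bar> powr p) \<le> \<delta> * (K powr p * R powr real DIM('a))"
      and tail: "Tail s p u x0 R \<le> K"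
      and dK: "R powr (l + s * p) * d powr p \<le> K powr p"
    have ut: "u \<in> tail_space s p" using u by (simp add: weak_DG_plus_def)
    have sub: "ball x0 (2 * R) \<subseteq> \<Omega>"
      using ball_infdist_frontier_subset[OF x0] dist by simp
    have "set_integrable lebesgue \<Omega> (\<lambda>x. \<bar>u x\<bar> powr p)"
      using u by (simp add: weak_DG_plus_def frac_sobolev_def Lp_space_def)
    then have int: "set_integrable lebesgue (ball x0 (2 * R)) (\<lambda>x. \<bar>u x\<bar> powr p)"
      by (rule set_integrable_subset) (use sub in auto)
    have avg1: "(LINT x:ball x0 (2 * R)|lebesgue. \<bar>u x\<bar> powr p) \<le> K powr p * R powr real DIM('a)"
    proof -
      have "\<delta> * (K powr p * R powr real DIM('a)) \<le> 1 * (K powr p * R powr real DIM('a))"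
        using \<delta> by (intro mult_right_mono) auto
      with avg show ?thesis by simp
    qed
    have half: "AE x in lebesgue. x \<in> ball y (R / 2) \<longrightarrow> u x \<le> K" if y: "y \<in> ball x0 R" for y
    proof -
      have suby: "ball y R \<subseteq> ball x0 (2 * R)"
      proof
        fix x assume "x \<in> ball y R"
        with y dist_triangle[of x0 x y] show "x \<in> ball x0 (2 * R)" by simp
      qed
      have y\<Omega>: "y \<in> \<Omega>" using sub y R by auto
      have "infdist x0 (frontier \<Omega>) \<le> infdist y (frontier \<Omega>) + dist x0 y"
        by (rule infdist_triangle)
      with dist y have disty: "R < infdist y (frontier \<Omega>)" by simp
      have inty: "set_integrable lebesgue (ball y R) (\<lambda>x. \<bar>u x\<bar> powr p)"
        by (rule set_integrable_subset[OF int]) (use suby in auto)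
      have "(LINT x:ball y R|lebesgue. \<bar>u x\<bar> powr p) \<le> (LINT x:ball x0 (2 * R)|lebesgue. \<bar>u x\<bar> powr p)"
        by (rule set_integral_nonneg_mono_set[OF int]) (use suby in auto)
      with avg have avgy: "(LINT x:ball y R|lebesgue. \<bar>u x\<bar> powr p) \<le> \<delta> * (K powr p * R powr real DIM('a))"
        by simp
      show ?thesis
      proof (rule local[OF ut R K l inty _ dK _ avgy])
        show "caccioppoli s p d H l y r \<rho> (\<lambda>x. pos_part (u x - k)) (A_plus u k y \<rho>)"
          if "0 < r" "r < \<rho>" "\<rho> \<le> R" for r \<rho> k
          using u y\<Omega> that disty by (simp add: weak_DG_plus_def)
        show "R powr (s * p) * Tail_bar s p u y (R / 2) powr (p - 1) \<le> M * K powr (p - 1)"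
          unfolding M_def by (rule Tail_bar_recentre[OF ut s(1) p R K y int avg1 tail])
      qed
    qed
    define F where "F = (\<lambda>y. ball y (R / 2)) ` ball x0 R"
    obtain F' where F': "F' \<subseteq> F" "countable F'" "\<Union>F' = \<Union>F"
      using Lindelof[of F] by (auto simp: F_def)
    have "AE x in lebesgue. x \<in> S \<longrightarrow> u x \<le> K" if "S \<in> F'" for S
      using that F'(1) half by (auto simp: F_def)
    then have "AE x in lebesgue. \<forall>S\<in>F'. x \<in> S \<longrightarrow> u x \<le> K"
      using F'(2) by (subst AE_ball_countable) auto
    moreover have "ball x0 R \<subseteq> \<Union>F'" using R by (auto simp: F'(3) F_def)
    ultimately show "AE x in lebesgue. x \<in> ball x0 R \<longrightarrow> u x \<le> K"
      by (auto elim!: eventually_mono)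
  qed
qed

lemma Linf_norm_le:
  assumes u: "u \<in> borel_measurable lebesgue" and U: "U \<in> sets lebesgue"
    and ae: "AE x in lebesgue. x \<in> U \<longrightarrow> \<bar>u x\<bar> \<le> K"
  shows "Linf_norm U u \<le> ennreal K"
  unfolding Linf_norm_def
proof (rule esssup_I)
  have "u \<in> borel_measurable (lebesgue_on U)" using u by (rule measurable_restrict_space1)
  then show "(\<lambda>x. ennreal \<bar>u x\<bar>) \<in> borel_measurable (lebesgue_on U)" by measurable
  show "AE x in lebesgue_on U. ennreal \<bar>u x\<bar> \<le> ennreal K"
    using ae U by (subst AE_restrict_space_iff) (auto elim!: eventually_mono intro: ennreal_leI)
qed

lemma AE_le_Linf_norm:
  assumes U: "U \<in> sets lebesgue"
  shows "AE x in lebesgue. x \<in> U \<longrightarrow> ennreal \<bar>u x\<bar> \<le> Linf_norm U u"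
proof -
  have "AE x in lebesgue_on U. ennreal \<bar>u x\<bar> \<le> Linf_norm U u"
    unfolding Linf_norm_def by (rule esssup_AE)
  then show ?thesis using U by (subst (asm) AE_restrict_space_iff) auto
qed

lemma Linf_locI:
  fixes u :: "'a::euclidean_space \<Rightarrow> real"
  assumes u: "u \<in> borel_measurable lebesgue"
    and loc: "\<And>x. x \<in> \<Omega> \<Longrightarrow> \<exists>r>0. Linf_norm (ball x r) u < \<infinity>"
  shows "u \<in> Linf_loc \<Omega>"
  unfolding Linf_loc_def
proof (intro CollectI conjI allI impI)
  show "u \<in> borel_measurable (lebesgue_on \<Omega>)" using u by (rule measurable_restrict_space1)
  fix K assume K: "compact K \<and> K \<subseteq> \<Omega>"
  obtain r where r: "\<And>x. x \<in> \<Omega> \<Longrightarrow> 0 < r x \<and> Linf_norm (ball x (r x)) u < \<infinity>"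
    using loc by metis
  obtain X where X: "X \<subseteq> K" "finite X" "K \<subseteq> (\<Union>x\<in>X. ball x (r x))"
  proof (rule compactE_image[of K K "\<lambda>x. ball x (r x)"])
    show "K \<subseteq> (\<Union>x\<in>K. ball x (r x))" using K r by fastforce
  qed (use K in auto)
  define m where "m = (\<Sum>x\<in>X. Linf_norm (ball x (r x)) u)"
  have m: "m < \<infinity>" using X K r by (auto simp: m_def)
  have le: "Linf_norm (ball x (r x)) u \<le> m" if "x \<in> X" for x
    unfolding m_def using that X by (intro member_le_sum) auto
  have "AE y in lebesgue. \<forall>x\<in>X. y \<in> ball x (r x) \<longrightarrow> ennreal \<bar>u y\<bar> \<le> Linf_norm (ball x (r x)) u"
    using X(2) by (intro AE_finite_allI AE_le_Linf_norm) auto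
  then have "AE y in lebesgue. y \<in> K \<longrightarrow> \<bar>u y\<bar> \<le> enn2real m"
  proof eventually_elim
    fix y assume y: "\<forall>x\<in>X. y \<in> ball x (r x) \<longrightarrow> ennreal \<bar>u y\<bar> \<le> Linf_norm (ball x (r x)) u"
    show "y \<in> K \<longrightarrow> \<bar>u y\<bar> \<le> enn2real m"
    proof
      assume "y \<in> K"
      then obtain x where "x \<in> X" "y \<in> ball x (r x)" using X(3) by auto
      then have "ennreal \<bar>u y\<bar> \<le> m" using y le by (meson order_trans)
      then show "\<bar>u y\<bar> \<le> enn2real m" using m enn2real_mono[of "ennreal \<bar>u y\<bar>" m] by simp
    qed
  qed
  then have "Linf_norm K u \<le> ennreal (enn2real m)"
    using K by (intro Linf_norm_le[OF u] fmeasurableD lmeasurable_compact) auto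
  also have "\<dots> < \<infinity>" by simp
  finally show "Linf_norm K u < \<infinity>" .
qed

theorem theorem2p2:
  fixes s p H :: real
  assumes "0 < s" and "s < 1" and "p > 1" and "real DIM('a::euclidean_space) > s * p" and "H \<ge> 1"
  shows "\<exists>C\<ge>1. \<forall>(\<Omega> :: 'a set) (d :: real) (l :: real) (u :: 'a \<Rightarrow> real).
    open \<Omega> \<and> bounded \<Omega> \<and> d \<ge> 0 \<and> l \<ge> 0 \<and> u \<in> weak_DG s p \<Omega> d H l \<longrightarrow>
      u \<in> Linf_loc \<Omega> \<and>
      (\<forall>x0\<in>\<Omega>. \<forall>R. 0 < R \<and> R < infdist x0 (frontier \<Omega>) / 2 \<longrightarrow>
        Linf_norm (ball x0 R) u \<le> ennreal (C *
          ((1 / measure lebesgue (ball x0 (2 * R))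
              * (LINT x:ball x0 (2 * R)|lebesgue. \<bar>u x\<bar> powr p)) powr (1 / p)
           + Tail s p u x0 R
           + R powr ((l + s * p) / p) * d)))"
proof -
  note s = assms(1,2) and p = assms(3) and H = assms(5)
  have p0: "0 < p" using p by simp
  obtain \<delta> where \<delta>: "0 < \<delta>" and bound:
    "\<And>(u :: 'a \<Rightarrow> real) \<Omega> x0 R d l K.
      u \<in> weak_DG_plus s p \<Omega> d H l \<Longrightarrow> 0 \<le> l \<Longrightarrow> x0 \<in> \<Omega> \<Longrightarrow>
      0 < R \<Longrightarrow> 2 * R < infdist x0 (frontier \<Omega>) \<Longrightarrow> 0 < K \<Longrightarrow>
      (LINT x:ball x0 (2 * R)|lebesgue. \<bar>u x\<bar> powr p) \<le> \<delta> * (K powr p * R powr real DIM('a)) \<Longrightarrow>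
      Tail s p u x0 R \<le> K \<Longrightarrow>
      R powr (l + s * p) * d powr p \<le> K powr p \<Longrightarrow>
      AE x in lebesgue. x \<in> ball x0 R \<longrightarrow> u x \<le> K"
    using sup_bound_ball[OF s p H, where 'a='a] by blast
  define V where "V = unit_ball_vol (real DIM('a)) * 2 ^ DIM('a)"
  have V: "0 < V" by (simp add: V_def)
  \<comment> \<open>With this constant, an \<open>L\<^sup>p\<close> mean over the double ball of at most \<open>K / C\<close> meets the threshold \<open>\<delta>\<close>.\<close>
  define C where "C = max 1 ((V / \<delta>) powr (1 / p))"
  have C1: "1 \<le> C" by (simp add: C_def)
  have CV: "V \<le> \<delta> * C powr p"
  proof -
    have "((V / \<delta>) powr (1 / p)) powr p \<le> C powr p"
      using p by (intro powr_mono2) (auto simp: C_def)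
    then show ?thesis using V \<delta> p by (simp add: powr_powr field_simps)
  qed
  define Q where "Q = (\<lambda>(l::real) d (u :: 'a \<Rightarrow> real) x0 R.
     (1 / measure lebesgue (ball x0 (2 * R))
              * (LINT x:ball x0 (2 * R)|lebesgue. \<bar>u x\<bar> powr p)) powr (1 / p)
           + Tail s p u x0 R + R powr ((l + s * p) / p) * d)"
  have main: "Linf_norm (ball x0 R) u \<le> ennreal (C * Q l d u x0 R)"
    if l: "0 \<le> l" and d: "0 \<le> d" and u: "u \<in> weak_DG s p \<Omega> d H l" and x0: "x0 \<in> \<Omega>"
      and R: "0 < R" and dist: "R < infdist x0 (frontier \<Omega>) / 2"
    for l d u x0 R and \<Omega> :: "'a set"
  proof (rule ennreal_le_epsilon)
    \<comment> \<open>The iteration needs a positive level \<open>K\<close>, while the right-hand side may vanish.\<close>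
    fix e :: real assume e: "0 < e"
    have um: "u \<in> borel_measurable lebesgue"
      using u by (auto simp: weak_DG_def weak_DG_plus_def tail_space_def)
    define I where "I = (LINT x:ball x0 (2 * R)|lebesgue. \<bar>u x\<bar> powr p)"
    have I0: "0 \<le> I" unfolding I_def by (rule set_integral_nonneg_fun) simp
    define m where "m = measure lebesgue (ball x0 (2 * R))"
    have m: "m = V * R powr real DIM('a)"
      using R by (simp add: m_def content_ball V_def powr_realpow power_mult_distrib)
    have m0: "0 < m" using V R by (simp add: m)
    define t1 where "t1 = (1 / m * I) powr (1 / p)"
    define t2 where "t2 = Tail s p u x0 R"
    define t3 where "t3 = R powr ((l + s * p) / p) * d"
    have t0: "0 \<le> t1" "0 \<le> t2" "0 \<le> t3" using d by (auto simp: t1_def t2_def t3_def Tail_def)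
    have Q: "Q l d u x0 R = t1 + t2 + t3"
      by (simp add: Q_def t1_def t2_def t3_def m_def I_def)
    define K where "K = C * (t1 + t2 + t3) + e"
    have K0: "0 < K" using C1 t0 e by (simp add: K_def add_nonneg_pos)
    have CK: "C * t1 + C * t2 + C * t3 < K" using e by (simp add: K_def distrib_left)
    have tC: "t2 \<le> C * t2" "t3 \<le> C * t3" "0 \<le> C * t1" "0 \<le> C * t2" "0 \<le> C * t3"
      using C1 t0 by (auto simp: mult_le_cancel_right1)
    have K2: "t2 \<le> K" and K3: "t3 \<le> K" and K1: "C * t1 \<le> K" using CK tC by linarith+
    have "(C * t1) powr p \<le> K powr p"
      using K1 tC p0 by (intro powr_mono2) auto
    moreover have "(C * t1) powr p = C powr p * (I / m)"
      using I0 m0 p0 by (simp add: t1_def powr_mult powr_powr)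
    ultimately have "C powr p * I \<le> K powr p * m" using m0 by (simp add: field_simps)
    also have "\<dots> \<le> K powr p * (\<delta> * C powr p * R powr real DIM('a))"
      unfolding m using CV by (intro mult_left_mono mult_right_mono) auto
    finally have "C powr p * I \<le> C powr p * (\<delta> * (K powr p * R powr real DIM('a)))"
      by (simp add: mult_ac)
    then have KI: "I \<le> \<delta> * (K powr p * R powr real DIM('a))" using C1 by simp
    have Kd: "R powr (l + s * p) * d powr p \<le> K powr p"
    proof -
      have "t3 powr p \<le> K powr p" using K3 t0 p0 by (intro powr_mono2) auto
      then show ?thesis using p0 by (simp add: t3_def powr_mult powr_powr)
    qed
    have dist2: "2 * R < infdist x0 (frontier \<Omega>)" using dist by simp
    have up: "u \<in> weak_DG_plus s p \<Omega> d H l" "(\<lambda>x. - u x) \<in> weak_DG_plus s p \<Omega> d H l"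
      using u weak_DG_minus_uminus by (auto simp: weak_DG_def)
    have "AE x in lebesgue. x \<in> ball x0 R \<longrightarrow> u x \<le> K"
      using KI K2 Kd by (intro bound[OF up(1) l x0 R dist2 K0]) (simp_all add: I_def t2_def)
    moreover have "AE x in lebesgue. x \<in> ball x0 R \<longrightarrow> - u x \<le> K"
      using KI K2 Kd by (intro bound[OF up(2) l x0 R dist2 K0]) (simp_all add: I_def t2_def Tail_def)
    ultimately have "AE x in lebesgue. x \<in> ball x0 R \<longrightarrow> \<bar>u x\<bar> \<le> K"
      by eventually_elim auto
    then have "Linf_norm (ball x0 R) u \<le> ennreal K"
      by (intro Linf_norm_le[OF um]) auto
    also have "ennreal K = ennreal (C * Q l d u x0 R) + ennreal e"
      using C1 t0 e by (simp add: K_def Q ennreal_plus)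
    finally show "Linf_norm (ball x0 R) u \<le> ennreal (C * Q l d u x0 R) + ennreal e" .
  qed
  have locb: "u \<in> Linf_loc \<Omega>"
    if op: "open \<Omega>" "bounded \<Omega>" and l: "0 \<le> l" and d: "0 \<le> d" and u: "u \<in> weak_DG s p \<Omega> d H l"
    for \<Omega> :: "'a set" and u d l
  proof (rule Linf_locI)
    show "u \<in> borel_measurable lebesgue"
      using u by (auto simp: weak_DG_def weak_DG_plus_def tail_space_def)
    fix x assume x: "x \<in> \<Omega>"
    define r where "r = infdist x (frontier \<Omega>) / 3"
    have r: "0 < r" "r < infdist x (frontier \<Omega>) / 2"
      using infdist_frontier_pos[OF op x] by (auto simp: r_def)
    have "Linf_norm (ball x r) u \<le> ennreal (C * Q l d u x r)"
      by (rule main[OF l d u x r])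
    also have "\<dots> < \<infinity>" by simp
    finally show "\<exists>r>0. Linf_norm (ball x r) u < \<infinity>" using r by blast
  qed
  show ?thesis
    by (rule exI[of _ C]) (use C1 main locb in \<open>auto simp: Q_def\<close>)
qed

end
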